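(* Let $\Omega\subset\mathbb{C}^n$ be a smooth bounded strongly pseudoconvex domain containing the origin. For $\varepsilon>0$ with $\overline{B_\varepsilon(0)}\subset\Omega$, let $\Omega_\varepsilon=\Omega\setminus\overline{B_\varepsilon(0)}$ and let $u_\varepsilon\in C^4(\Omega_\varepsilon)\cap C^2(\overline{\Omega_\varepsilon})$ be a plurisubharmonic solution of $$\det\big((u_\varepsilon)_{i\bar j}\big)=\varepsilon>0\quad\text{in }\Omega_\varepsilon,$$ satisfying, with constants $C_1,C_2$ independent of $\varepsilon$, $$\sup_{\partial\Omega_\varepsilon}|z|^2|D^2u_\varepsilon(z)|\le C_2,\qquad \sup_{\Omega_\varepsilon}|z|\,|Du_\varepsilon(z)|\le C_1 .$$ Then there exists a constant $C>0$, independent of $\varepsilon$, such that $$|D^2u_\varepsilon(z)|\le\frac{C}{|z|^2}\quad\text{in }\overline{\Omega_\varepsilon}.$$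
   Context: $Du$ and $D^2u$ denote the real gradient and real Hessian under $\mathbb{C}^n\simeq\mathbb{R}^{2n}$, and $u_{i\bar j}=\partial^2u/\partial z_i\partial\bar z_j$. $B_\varepsilon(0)$ is the Euclidean ball of radius $\varepsilon$ centered at the origin. *)

theory Defs
  imports "HOL-Analysis.Analysis"
begin

text \<open>The space \<open>\<complex>\<^sup>n\<close> is \<open>complex ^ 'n\<close>. As a real Euclidean space it is \<open>\<real>\<^sup>2\<^sup>n\<close>: its
  \<open>Basis\<close> consists of the vectors \<open>axis i 1\<close> (the direction of \<open>Re z\<^sub>i\<close>) and \<open>axis i \<i>\<close>
  (the direction of \<open>Im z\<^sub>i\<close>).\<close>

definition pd :: "'a::real_normed_vector \<Rightarrow> ('a \<Rightarrow> 'b::real_normed_vector) \<Rightarrow> 'a \<Rightarrow> 'b" where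
  "pd v f z = frechet_derivative f (at z) v"

text \<open>The class \<open>C\<^sup>k(S)\<close>; meant for open \<open>S\<close>.\<close>

fun Ck_on :: "nat \<Rightarrow> ('a::euclidean_space \<Rightarrow> 'b::real_normed_vector) \<Rightarrow> 'a set \<Rightarrow> bool" where
  "Ck_on 0 f S \<longleftrightarrow> continuous_on S f"
| "Ck_on (Suc k) f S \<longleftrightarrow>
     (\<forall>z\<in>S. f differentiable (at z)) \<and> (\<forall>b\<in>Basis. Ck_on k (pd b f) S)"

text \<open>The class \<open>C\<^sup>k\<close> of the closure of an open set \<open>S\<close>: all partial derivatives in \<open>S\<close> of order at
  most \<open>k\<close> extend continuously to the closure. Only the values of \<open>f\<close> on \<open>S\<close> matter.\<close>

definition extends_to_closure ::
    "('a::topological_space \<Rightarrow> 'b::topological_space) \<Rightarrow> 'a set \<Rightarrow> bool" where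
  "extends_to_closure f S \<longleftrightarrow> (\<exists>g. continuous_on (closure S) g \<and> (\<forall>z\<in>S. g z = f z))"

fun Ck_closure :: "nat \<Rightarrow> ('a::euclidean_space \<Rightarrow> 'b::real_normed_vector) \<Rightarrow> 'a set \<Rightarrow> bool" where
  "Ck_closure 0 f S \<longleftrightarrow> extends_to_closure f S"
| "Ck_closure (Suc k) f S \<longleftrightarrow>
     extends_to_closure f S \<and> (\<forall>z\<in>S. f differentiable (at z)) \<and>
     (\<forall>b\<in>Basis. Ck_closure k (pd b f) S)"

text \<open>At a point of \<open>closure S - S\<close> this is the value of the continuous extension of \<open>f\<close>,
  whenever that extension exists.\<close>

definition cont_ext ::
    "'a set \<Rightarrow> ('a::topological_space \<Rightarrow> 'b::t2_space) \<Rightarrow> 'a \<Rightarrow> 'b" where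
  "cont_ext S f z = (if z \<in> S then f z else Lim (at z within S) f)"

definition grad :: "('a::euclidean_space \<Rightarrow> real) \<Rightarrow> 'a \<Rightarrow> 'a" where
  "grad u z = (\<Sum>b\<in>Basis. pd b u z *\<^sub>R b)"

text \<open>The Frobenius norm of the real Hessian \<open>D\<^sup>2u\<close>, whose entries are continuously extended from
  the open set \<open>S\<close> to its closure.\<close>

definition hess_norm :: "'a set \<Rightarrow> ('a::euclidean_space \<Rightarrow> real) \<Rightarrow> 'a \<Rightarrow> real" where
  "hess_norm S u z = sqrt (\<Sum>a\<in>Basis. \<Sum>b\<in>Basis. (cont_ext S (pd a (pd b u)) z)\<^sup>2)"

definition d_z :: "'n::finite \<Rightarrow> (complex ^ 'n \<Rightarrow> complex) \<Rightarrow> complex ^ 'n \<Rightarrow> complex" where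
  "d_z i f z = (pd (axis i 1) f z - \<i> * pd (axis i \<i>) f z) / 2"

definition d_zbar :: "'n::finite \<Rightarrow> (complex ^ 'n \<Rightarrow> complex) \<Rightarrow> complex ^ 'n \<Rightarrow> complex" where
  "d_zbar i f z = (pd (axis i 1) f z + \<i> * pd (axis i \<i>) f z) / 2"

definition complex_hessian ::
    "(complex ^ 'n::finite \<Rightarrow> real) \<Rightarrow> complex ^ 'n \<Rightarrow> complex ^ 'n ^ 'n" where
  "complex_hessian u z = (\<chi> i j. d_z i (d_zbar j (\<lambda>w. complex_of_real (u w))) z)"

text \<open>Plurisubharmonicity of a function that does not take the value \<open>-\<infinity>\<close>: upper
  semicontinuity and the sub-mean value inequality on all closed complex discs inside \<open>S\<close>.
  Since an upper semicontinuous function is bounded above on a circle, its mean is either finite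
  or \<open>-\<infinity>\<close>; the inequality rules out the latter, so integrability belongs to the condition.\<close>

definition plurisubharmonic_on ::
    "(complex ^ 'n::finite \<Rightarrow> real) \<Rightarrow> (complex ^ 'n) set \<Rightarrow> bool" where
  "plurisubharmonic_on u S \<longleftrightarrow>
     (\<forall>z\<in>S. \<forall>a>u z. \<forall>\<^sub>F w in at z within S. u w < a) \<and>
     (\<forall>z w. (\<forall>\<zeta>. norm \<zeta> \<le> 1 \<longrightarrow> z + \<zeta> *s w \<in> S) \<longrightarrow>
        (\<lambda>t. u (z + cis t *s w)) integrable_on {0..2 * pi} \<and>
        u z \<le> 1 / (2 * pi) * integral {0..2 * pi} (\<lambda>t. u (z + cis t *s w)))"

text \<open>A bounded domain with \<open>C\<^sup>\<infinity>\<close> boundary, given by a defining function \<open>\<rho>\<close> near the boundary,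
  whose Levi form is positive definite on the complex tangent spaces of the boundary.\<close>

definition smooth_bounded_strongly_pseudoconvex_domain :: "(complex ^ 'n::finite) set \<Rightarrow> bool" where
  "smooth_bounded_strongly_pseudoconvex_domain \<Omega> \<longleftrightarrow>
     open \<Omega> \<and> connected \<Omega> \<and> \<Omega> \<noteq> {} \<and> bounded \<Omega> \<and>
     (\<exists>U \<rho>. open U \<and> frontier \<Omega> \<subseteq> U \<and> (\<forall>k. Ck_on k \<rho> U) \<and>
        \<Omega> \<inter> U = {z \<in> U. \<rho> z < 0} \<and>
        (\<forall>p\<in>frontier \<Omega>. grad \<rho> p \<noteq> 0 \<and>
           (\<forall>w. w \<noteq> 0 \<and> (\<Sum>i\<in>UNIV. d_z i (\<lambda>z. complex_of_real (\<rho> z)) p * w $ i) = 0 \<longrightarrow>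
              Re (\<Sum>i\<in>UNIV. \<Sum>j\<in>UNIV. complex_hessian \<rho> p $ i $ j * w $ i * cnj (w $ j)) > 0)))"

end

theory Submission
  imports Defs
begin

text \<open>The complex Monge--Ampere equation with constant right-hand side is invariant, up to a constant factor,
  under complex linear changes of coordinates. Let \<open>G s\<close> be the flow of the linear holomorphic vector field
  \<open>z \<mapsto> M *v z\<close>. Then \<open>log det\<close> of the complex Hessian of \<open>u \<circ> G s\<close> is affine in \<open>s\<close>, and by the concavity of
  \<open>log det\<close> the second derivative of \<open>u\<close> along the flow,
  \<open>v z = D\<^sup>2u(z)(M z, M z) + Du(z)(M\<^sup>2 z)\<close>, is a subsolution of the linearized equation. So \<open>v\<close> satisfies the
  maximum principle. As \<open>M z\<close> has size of order \<open>|z|\<close>, the weighted bounds for \<open>D\<^sup>2u\<close> on the boundary and for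
  \<open>Du\<close> bound \<open>v\<close> on the boundary, hence everywhere, by a constant that does not depend on \<open>\<epsilon>\<close>. For given
  \<open>z \<noteq> 0\<close> and a unit vector \<open>w\<close> there is a matrix \<open>M\<close>, bounded in terms of the dimension, with \<open>M z = |z| w\<close>;
  this gives \<open>|z|\<^sup>2 D\<^sup>2u(z)(w, w) \<le> C\<close>. The lower bound follows because plurisubharmonicity makes
  \<open>D\<^sup>2u(w, w) + D\<^sup>2u(\<i>w, \<i>w)\<close> nonnegative, and polarization bounds the whole Hessian.

  The maximum principle (\<open>flow_maximum_principle\<close>) is proved without differentiating the equation. An interior
  maximum of \<open>v\<close>, perturbed by a small multiple of \<open>|z|\<^sup>2\<close>, persists when \<open>v\<close> is replaced by the second
  difference quotient of \<open>u\<close> along the flow. At such a maximum the complex Hessians \<open>A\<close>, \<open>B\<close> and \<open>H\<close> of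
  \<open>u \<circ> G h\<close>, \<open>u \<circ> G (- h)\<close> and \<open>u\<close> satisfy \<open>A + B < 2 H\<close> and \<open>det A * det B = (det H)\<^sup>2\<close>, which contradicts the
  monotonicity and log-concavity of the determinant (\<open>det_mid_less\<close>). The passage from the maximum principle to the estimate is
  \<open>directional_bound\<close> and \<open>interior_hessian_bound\<close>.\<close>

section \<open>Determinants of positive definite Hermitian matrices\<close>

definition hermitian_matrix :: "complex ^ 'n ^ 'n \<Rightarrow> bool" where
  "hermitian_matrix M \<longleftrightarrow> (\<forall>i j. M $ j $ i = cnj (M $ i $ j))"

definition herm_form :: "complex ^ 'n ^ 'n \<Rightarrow> complex ^ 'n::finite \<Rightarrow> real" where
  "herm_form M x = Re (\<Sum>i\<in>UNIV. \<Sum>j\<in>UNIV. M $ i $ j * x $ i * cnj (x $ j))"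

definition positive_definite :: "complex ^ 'n ^ 'n::finite \<Rightarrow> bool" where
  "positive_definite M \<longleftrightarrow> hermitian_matrix M \<and> (\<forall>x. x \<noteq> 0 \<longrightarrow> herm_form M x > 0)"

text \<open>The Schur complement of the \<open>k\<close>-th pivot, padded with a row and a column of the identity so that it
  stays a matrix of the same size and induction on the number of remaining pivots is possible.\<close>

definition schur_reduct :: "'n \<Rightarrow> complex ^ 'n ^ 'n \<Rightarrow> complex ^ 'n ^ 'n::finite" where
  "schur_reduct k M = (\<chi> i j. if i = k \<or> j = k then (if i = j then 1 else 0)
     else M $ i $ j - M $ i $ k * M $ k $ j / M $ k $ k)"

lemma hermitian_matrix_cnj: "hermitian_matrix M \<Longrightarrow> cnj (M $ i $ j) = M $ j $ i"
  by (metis hermitian_matrix_def)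

lemma herm_form_axis: "herm_form M (axis k 1) = Re (M $ k $ k)"
proof -
  have "M $ i $ j * axis k 1 $ i * cnj (axis k 1 $ j) =
      (if j = k then if i = k then M $ i $ j else 0 else 0)" for i j
    by (simp add: axis_def)
  then show ?thesis by (simp add: herm_form_def)
qed

lemma positive_definite_diag:
  assumes "positive_definite M"
  shows "M $ k $ k = complex_of_real (Re (M $ k $ k))" "Re (M $ k $ k) > 0"
proof -
  have "cnj (M $ k $ k) = M $ k $ k"
    using assms by (simp add: positive_definite_def hermitian_matrix_cnj)
  from arg_cong[OF this, of Im] have "Im (M $ k $ k) = 0" by simp
  then show "M $ k $ k = complex_of_real (Re (M $ k $ k))"
    by (intro complex_eqI) simp_all
  have "axis k (1::complex) \<noteq> 0" by (simp add: axis_eq_0_iff)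
  then show "Re (M $ k $ k) > 0"
    using assms herm_form_axis[of M k] by (metis positive_definite_def)
qed

text \<open>Cramer's rule for the identity matrix.\<close>

lemma det_identity_replace_column:
  fixes x :: "'n::finite \<Rightarrow> 'a::field"
  shows "det (\<chi> i j. if j = k then x i else if i = j then 1 else 0) = x k"
proof -
  have "(\<chi> i j. if j = k then x i else if i = j then 1 else 0) =
      (\<chi> i j. if j = k then (mat 1 *v (\<chi> i. x i)) $ i else mat 1 $ i $ j)"
    by (simp only: matrix_vector_mul_lid) (simp add: vec_eq_iff mat_def)
  then show ?thesis
    by (simp add: cramer_lemma)
qed

lemma sum_split_index:
  fixes f :: "'n::finite \<Rightarrow> 'a::comm_monoid_add"
  shows "(\<Sum>i\<in>UNIV. f i) = f k + (\<Sum>i\<in>UNIV-{k}. f i)"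
  using sum.remove[of UNIV k f] by simp

text \<open>One step of symmetric Gaussian elimination, written as a factorisation \<open>L ** schur_reduct k M ** R\<^sup>T\<close>
  in which \<open>L\<close> and \<open>R\<close> are the identity except in column \<open>k\<close>.\<close>

lemma det_schur_reduct:
  fixes M :: "complex ^ 'n ^ 'n::finite"
  assumes "M $ k $ k \<noteq> 0"
  shows "det M = M $ k $ k * det (schur_reduct k M)"
proof -
  define L :: "complex^'n^'n" where "L = (\<chi> i j. if j = k then M$i$k else if i = j then 1 else 0)"
  define R :: "complex^'n^'n" where
    "R = (\<chi> i j. if j = k then M$k$i / M$k$k else if i = j then 1 else 0)"
  have dL: "det L = M$k$k"
    using det_identity_replace_column[of k "\<lambda>i. M$i$k"] by (simp add: L_def)
  have dR: "det R = 1"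
    using det_identity_replace_column[of k "\<lambda>i. M$k$i / M$k$k"] assms by (simp add: R_def)
  have "M = L ** schur_reduct k M ** transpose R"
  proof -
    have "(L ** schur_reduct k M ** transpose R) $ i $ j = M $ i $ j" for i j
    proof -
      have LE: "(L ** schur_reduct k M) $ i $ b =
          (if b = k then M$i$k else if i = k then 0 else schur_reduct k M $ i $ b)" for b
      proof -
        have "(L ** schur_reduct k M) $ i $ b = L$i$k * schur_reduct k M $ k $ b +
            (\<Sum>a\<in>UNIV-{k}. L$i$a * schur_reduct k M $ a $ b)"
          by (simp add: matrix_matrix_mult_def sum_split_index[of _ k])
        also have "(\<Sum>a\<in>UNIV-{k}. L$i$a * schur_reduct k M $ a $ b) =
            (\<Sum>a\<in>UNIV-{k}. if i = a then schur_reduct k M $ a $ b else 0)"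
          by (rule sum.cong) (auto simp: L_def)
        finally show ?thesis
          by (auto simp: L_def schur_reduct_def)
      qed
      have "(L ** schur_reduct k M ** transpose R) $ i $ j =
          (L ** schur_reduct k M) $ i $ k * R$j$k +
          (\<Sum>b\<in>UNIV-{k}. (L ** schur_reduct k M) $ i $ b * R$j$b)"
        by (simp add: matrix_matrix_mult_def[of "L ** schur_reduct k M"] transpose_def
            sum_split_index[of _ k])
      also have "(\<Sum>b\<in>UNIV-{k}. (L ** schur_reduct k M) $ i $ b * R$j$b) =
          (\<Sum>b\<in>UNIV-{k}. if j = b then (L ** schur_reduct k M) $ i $ b else 0)"
        by (rule sum.cong) (auto simp: R_def)
      finally have "(L ** schur_reduct k M ** transpose R) $ i $ j =
          M $ i $ k * R $ j $ k + (if j = k then 0 else (L ** schur_reduct k M) $ i $ j)"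
        by (simp add: LE[of k])
      also have "\<dots> = M $ i $ j"
        using assms LE[of j] by (cases "i = k"; cases "j = k") (simp_all add: R_def schur_reduct_def)
      finally show ?thesis .
    qed
    then show ?thesis by (simp add: vec_eq_iff)
  qed
  then have "det M = det L * det (schur_reduct k M) * det R"
    by (metis det_mul det_transpose)
  then show ?thesis by (simp add: dL dR)
qed

lemma det_positive_definite_pivot:
  assumes "positive_definite M"
  shows "det M = of_real (Re (M $ k $ k)) * det (schur_reduct k M)"
  using det_schur_reduct[of M k] positive_definite_diag[OF assms, of k]
  by (metis less_irrefl zero_complex.simps(1))

text \<open>Completion of the square in the variable \<open>x $ k\<close>: the last summand is the only one that depends on \<open>x $ k\<close>,
  because the padding of the Schur complement contributes exactly the square that is subtracted.\<close>

lemma herm_form_schur_reduct: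
  assumes H: "hermitian_matrix M" and nz: "M $ k $ k \<noteq> 0"
  shows "herm_form M x = herm_form (schur_reduct k M) x - (norm (x $ k))\<^sup>2
    + (norm (\<Sum>i\<in>UNIV. M $ i $ k * x $ i))\<^sup>2 / Re (M $ k $ k)"
proof -
  have "cnj (M $ k $ k) = M $ k $ k"
    using H by (simp add: hermitian_matrix_cnj)
  from arg_cong[OF this, of Im] have "Im (M $ k $ k) = 0" by simp
  then have real: "M $ k $ k = complex_of_real (Re (M $ k $ k))"
    by (intro complex_eqI) simp_all
  define r where "r = Re (M$k$k)"
  have Mkk: "M$k$k = complex_of_real r" and r0: "r \<noteq> 0"
    using real nz by (auto simp: r_def)
  define \<sigma> where "\<sigma> = (\<Sum>i\<in>UNIV. M $ i $ k * x $ i)"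
  have cs: "cnj \<sigma> = (\<Sum>j\<in>UNIV. M $ k $ j * cnj (x $ j))"
    using H by (simp add: \<sigma>_def cnj_sum hermitian_matrix_cnj)
  have entry: "M$i$j = schur_reduct k M $ i $ j - (if i = k \<and> j = k then 1 else 0)
      + M$i$k * M$k$j / M$k$k" for i j
    using nz by (auto simp: schur_reduct_def)
  have A: "M$i$j * x$i * cnj (x$j) = schur_reduct k M $ i $ j * x$i * cnj (x$j)
      - (if i = k then if j = k then x$i * cnj (x$j) else 0 else 0)
      + (M$i$k * x$i) * (M$k$j * cnj (x$j)) / M$k$k" for i j
    by (subst entry) (auto simp: algebra_simps)
  have "(\<Sum>i\<in>UNIV. \<Sum>j\<in>UNIV. (if i = k then if j = k then x$i * cnj (x$j) else 0 else 0)) = (\<Sum>i\<in>UNIV. if i = k then x$i * cnj (x$k) else 0)"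
    by (intro sum.cong) auto
  then have B: "(\<Sum>i\<in>UNIV. \<Sum>j\<in>UNIV. (if i = k then if j = k then x$i * cnj (x$j) else 0 else 0)) = x$k * cnj (x$k)"
    by simp
  have C: "(\<Sum>i\<in>UNIV. \<Sum>j\<in>UNIV. (M$i$k * x$i) * (M$k$j * cnj (x$j)) / M$k$k) = \<sigma> * cnj \<sigma> / M$k$k"
    by (simp only: cs, simp only: \<sigma>_def sum_product sum_divide_distrib)
  have "(\<Sum>i\<in>UNIV. \<Sum>j\<in>UNIV. M $ i $ j * x $ i * cnj (x $ j)) =
     (\<Sum>i\<in>UNIV. \<Sum>j\<in>UNIV. schur_reduct k M $ i $ j * x$i * cnj (x$j)) - x$k * cnj (x$k) + \<sigma> * cnj \<sigma> / M$k$k"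
    by (simp only: A sum.distrib sum_subtractf B C)
  then have "herm_form M x = herm_form (schur_reduct k M) x - Re (x$k * cnj (x$k)) + Re (\<sigma> * cnj \<sigma> / M$k$k)"
    by (simp add: herm_form_def)
  also have "Re (x$k * cnj (x$k)) = (norm (x$k))\<^sup>2"
    by (simp add: complex_mult_cnj cmod_power2)
  also have "Re (\<sigma> * cnj \<sigma> / M$k$k) = (norm \<sigma>)\<^sup>2 / r"
    by (simp add: Mkk complex_mult_cnj cmod_power2)
  finally show ?thesis by (simp add: \<sigma>_def r_def)
qed

lemma herm_form_schur_reduct_cong:
  assumes "\<And>i. i \<noteq> k \<Longrightarrow> x $ i = y $ i"
  shows "herm_form (schur_reduct k M) x - (norm (x $ k))\<^sup>2 =
    herm_form (schur_reduct k M) y - (norm (y $ k))\<^sup>2"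
proof -
  have *: "herm_form (schur_reduct k M) x - (norm (x $ k))\<^sup>2 =
      Re (\<Sum>i\<in>UNIV-{k}. \<Sum>j\<in>UNIV-{k}. schur_reduct k M $ i $ j * x $ i * cnj (x $ j))" for x
  proof -
    have "(\<Sum>i\<in>UNIV. \<Sum>j\<in>UNIV. schur_reduct k M $ i $ j * x $ i * cnj (x $ j)) =
      x$k * cnj (x$k) + (\<Sum>i\<in>UNIV-{k}. \<Sum>j\<in>UNIV-{k}. schur_reduct k M $ i $ j * x $ i * cnj (x $ j))"
      by (simp add: sum_split_index[of _ k], simp add: schur_reduct_def)
    then show ?thesis
      by (simp add: herm_form_def complex_mult_cnj cmod_power2)
  qed
  show ?thesis
    unfolding * using assms by (intro arg_cong[where f=Re] sum.cong refl) auto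
qed

text \<open>By completion of the square the Schur complement is a lower bound for the form over all values of the
  \<open>k\<close>-th coordinate. Together with the next lemma it is the minimum.\<close>

lemma herm_form_schur_reduct_le:
  assumes "positive_definite M" "\<And>i. i \<noteq> k \<Longrightarrow> x $ i = y $ i"
  shows "herm_form (schur_reduct k M) x - (norm (x $ k))\<^sup>2 \<le> herm_form M y"
proof -
  have "M$k$k \<noteq> 0" using positive_definite_diag(2)[OF assms(1), of k] by auto
  then show ?thesis
    using herm_form_schur_reduct[of M k y] herm_form_schur_reduct_cong[OF assms(2), of k M]
      assms(1) positive_definite_diag(2)[OF assms(1), of k]
    by (simp add: positive_definite_def)
qed

lemma schur_reduct_minimiser:
  assumes "positive_definite M"
  obtains y where "\<And>i. i \<noteq> k \<Longrightarrow> x $ i = y $ i"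
    "herm_form M y = herm_form (schur_reduct k M) x - (norm (x $ k))\<^sup>2"
proof -
  have nz: "M$k$k \<noteq> 0" using positive_definite_diag(2)[OF assms(1), of k] by auto
  \<comment> \<open>The value of the coordinate \<open>k\<close> at which the square in \<open>herm_form_schur_reduct\<close> vanishes.\<close>
  define y where "y = (\<chi> i. if i = k then - (\<Sum>i\<in>UNIV-{k}. M$i$k * x$i) / M$k$k else x $ i)"
  have xy: "x $ i = y $ i" if "i \<noteq> k" for i using that by (simp add: y_def)
  have "(\<Sum>i\<in>UNIV-{k}. M$i$k * y$i) = (\<Sum>i\<in>UNIV-{k}. M$i$k * x$i)"
    by (rule sum.cong) (auto simp: y_def)
  then have "(\<Sum>i\<in>UNIV. M$i$k * y$i) = 0"
    using nz by (simp add: sum_split_index[of _ k]) (simp add: y_def)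
  then have "herm_form M y = herm_form (schur_reduct k M) x - (norm (x $ k))\<^sup>2"
    using herm_form_schur_reduct[of M k y] nz herm_form_schur_reduct_cong[OF xy, of k M] assms
    by (simp add: positive_definite_def)
  with xy show thesis using that by blast
qed

lemma positive_definite_schur_reduct:
  assumes "positive_definite M"
  shows "positive_definite (schur_reduct k M)"
proof -
  have "hermitian_matrix (schur_reduct k M)"
    using assms unfolding positive_definite_def hermitian_matrix_def[of "schur_reduct k M"]
    by (auto simp: schur_reduct_def hermitian_matrix_cnj mult.commute)
  moreover have "herm_form (schur_reduct k M) x > 0" if "x \<noteq> 0" for x
  proof -
    obtain y where y: "\<And>i. i \<noteq> k \<Longrightarrow> x $ i = y $ i"
      "herm_form M y = herm_form (schur_reduct k M) x - (norm (x $ k))\<^sup>2"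
      using schur_reduct_minimiser[OF assms, of k x] by metis
    have ge: "herm_form M y \<ge> 0"
      using assms by (cases "y = 0") (auto simp: positive_definite_def herm_form_def less_imp_le)
    show ?thesis
    proof (cases "x $ k = 0")
      case True
      then have "y \<noteq> 0" using that y(1) by (metis vec_eq_iff zero_index)
      then show ?thesis using y(2) True assms unfolding positive_definite_def
        by (metis diff_zero norm_zero power_zero_numeral)
    next
      case False
      then have "(norm (x $ k))\<^sup>2 > 0" by simp
      then show ?thesis using y(2) ge by linarith
    qed
  qed
  ultimately show ?thesis by (simp add: positive_definite_def)
qed

text \<open>Being a minimum over one coordinate, the Schur complement is a concave function of the form. Hence a
  comparison of \<open>A + B\<close> with \<open>2 H\<close> survives elimination: at the minimiser for \<open>H\<close> the forms of \<open>A\<close> and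
  \<open>B\<close> are at least their own minima.\<close>

lemma schur_reduct_mid_le:
  assumes "positive_definite A" "positive_definite B" "positive_definite H"
    and le: "\<And>x. herm_form A x + herm_form B x \<le> 2 * herm_form H x"
  shows "herm_form (schur_reduct k A) x + herm_form (schur_reduct k B) x
    \<le> 2 * herm_form (schur_reduct k H) x"
proof -
  obtain y where y: "\<And>i. i \<noteq> k \<Longrightarrow> x $ i = y $ i"
      "herm_form H y = herm_form (schur_reduct k H) x - (norm (x $ k))\<^sup>2"
    using schur_reduct_minimiser[OF assms(3), of k x] by metis
  have "herm_form (schur_reduct k A) x - (norm (x $ k))\<^sup>2 \<le> herm_form A y"
    "herm_form (schur_reduct k B) x - (norm (x $ k))\<^sup>2 \<le> herm_form B y"
    using y(1) by (intro herm_form_schur_reduct_le assms; simp)+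
  then show ?thesis
    using y(2) le[of y] by argo
qed

lemma mult_le_square_mid:
  fixes a b h :: real
  assumes "0 < a" "0 < b" "a + b \<le> 2 * h"
  shows "a * b \<le> h\<^sup>2"
proof -
  have "4 * (a * b) \<le> (a + b)\<^sup>2"
    using zero_le_square[of "a - b"] by (simp add: power2_eq_square algebra_simps)
  also have "\<dots> \<le> (2 * h)\<^sup>2" using assms by (intro power_mono) auto
  finally show ?thesis by simp
qed

text \<open>Monotonicity and log-concavity of the determinant at once. All pivots are eliminated one after the other;
  each step keeps the hypotheses, by the previous lemmas, and compares one pivot by the inequality between
  the arithmetic and the geometric mean. The set \<open>S\<close> of the induction contains the indices whose pivot is not
  yet eliminated.\<close>

lemma det_mid_le:
  fixes A B H :: "complex ^ 'n ^ 'n::finite"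
  assumes "positive_definite A" "positive_definite B" "positive_definite H"
    and "\<And>x. herm_form A x + herm_form B x \<le> 2 * herm_form H x"
  obtains a b h :: real where "det A = of_real a" "det B = of_real b" "det H = of_real h"
    "0 < a" "0 < b" "0 < h" "a * b \<le> h\<^sup>2"
proof -
  define I :: "'n set \<Rightarrow> complex ^ 'n ^ 'n \<Rightarrow> bool" where
    "I S M \<longleftrightarrow> (\<forall>i j. i \<notin> S \<or> j \<notin> S \<longrightarrow> M $ i $ j = (if i = j then 1 else 0))" for S M
  have "\<exists>a b h :: real. det A = of_real a \<and> det B = of_real b \<and> det H = of_real h \<and>
      0 < a \<and> 0 < b \<and> 0 < h \<and> a * b \<le> h\<^sup>2"
    if "finite S" "I S A" "I S B" "I S H"
      "positive_definite A" "positive_definite B" "positive_definite H"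
      "\<And>x. herm_form A x + herm_form B x \<le> 2 * herm_form H x"
    for S and A B H :: "complex ^ 'n ^ 'n"
    using that
  proof (induction S arbitrary: A B H rule: finite_induct)
    case empty
    then have "A = mat 1" "B = mat 1" "H = mat 1"
      by (auto simp: I_def vec_eq_iff mat_def)
    then show ?case by (intro exI[of _ 1]) auto
  next
    case (insert k S)
    have red: "I S (schur_reduct k M)" if "I (insert k S) M" for M
      using that insert.hyps unfolding I_def by (auto simp: schur_reduct_def)
    have "\<exists>a b h :: real. det (schur_reduct k A) = of_real a \<and> det (schur_reduct k B) = of_real b \<and>
      det (schur_reduct k H) = of_real h \<and> 0 < a \<and> 0 < b \<and> 0 < h \<and> a * b \<le> h\<^sup>2"
      using insert.prems
      by (intro insert.IH red positive_definite_schur_reduct schur_reduct_mid_le) auto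
    then obtain a b h :: real where d: "det (schur_reduct k A) = of_real a"
      "det (schur_reduct k B) = of_real b" "det (schur_reduct k H) = of_real h"
      "0 < a" "0 < b" "0 < h" "a * b \<le> h\<^sup>2" by blast
    define \<alpha> \<beta> \<eta> where "\<alpha> = Re (A $ k $ k)" "\<beta> = Re (B $ k $ k)" "\<eta> = Re (H $ k $ k)"
    have pos: "\<alpha> > 0" "\<beta> > 0" "\<eta> > 0"
      using positive_definite_diag(2) insert.prems by (auto simp: \<alpha>_\<beta>_\<eta>_def)
    have "\<alpha> * \<beta> \<le> \<eta>\<^sup>2"
      using insert.prems(7)[of "axis k 1"] pos
      by (intro mult_le_square_mid) (auto simp: herm_form_axis \<alpha>_\<beta>_\<eta>_def)
    then have "(\<alpha> * \<beta>) * (a * b) \<le> \<eta>\<^sup>2 * h\<^sup>2"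
      using d pos by (intro mult_mono) auto
    then have "(\<alpha> * a) * (\<beta> * b) \<le> (\<eta> * h)\<^sup>2"
      by (simp add: power_mult_distrib mult_ac)
    then show ?case
      using det_positive_definite_pivot[where k=k] insert.prems d pos
      by (intro exI[of _ "\<alpha> * a"] exI[of _ "\<beta> * b"] exI[of _ "\<eta> * h"])
        (auto simp: \<alpha>_\<beta>_\<eta>_def)
  qed
  from this[of UNIV A B H] assms
  have "\<exists>a b h :: real. det A = of_real a \<and> det B = of_real b \<and> det H = of_real h \<and>
      0 < a \<and> 0 < b \<and> 0 < h \<and> a * b \<le> h\<^sup>2"
    by (simp add: I_def)
  then show thesis using that by blast
qed

text \<open>The strict version: a single pivot with a strict inequality is enough.\<close>

proposition det_mid_less:
  fixes A B H :: "complex ^ 'n ^ 'n::finite"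
  assumes pd: "positive_definite A" "positive_definite B" "positive_definite H"
    and less: "\<And>x. x \<noteq> 0 \<Longrightarrow> herm_form A x + herm_form B x < 2 * herm_form H x"
  shows "det A * det B \<noteq> (det H)\<^sup>2"
proof -
  have le: "herm_form A x + herm_form B x \<le> 2 * herm_form H x" for x
    using less[of x] by (cases "x = 0") (auto simp: herm_form_def)
  define k :: 'n where "k = undefined"
  obtain a b h :: real where d: "det (schur_reduct k A) = of_real a"
      "det (schur_reduct k B) = of_real b" "det (schur_reduct k H) = of_real h"
      "0 < a" "0 < b" "0 < h" "a * b \<le> h\<^sup>2"
    using det_mid_le[OF positive_definite_schur_reduct[OF pd(1)]
        positive_definite_schur_reduct[OF pd(2)] positive_definite_schur_reduct[OF pd(3)]
        schur_reduct_mid_le[OF pd le]] by metis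
  define \<alpha> \<beta> \<eta> where "\<alpha> = Re (A $ k $ k)" "\<beta> = Re (B $ k $ k)" "\<eta> = Re (H $ k $ k)"
  have pos: "\<alpha> > 0" "\<beta> > 0" "\<eta> > 0"
    using positive_definite_diag(2) pd by (auto simp: \<alpha>_\<beta>_\<eta>_def)
  have "\<alpha> + \<beta> < 2 * \<eta>"
    using less[of "axis k 1"] by (simp add: herm_form_axis \<alpha>_\<beta>_\<eta>_def axis_eq_0_iff)
  then have "\<alpha> * \<beta> \<le> ((\<alpha> + \<beta>) / 2)\<^sup>2" "((\<alpha> + \<beta>) / 2)\<^sup>2 < \<eta>\<^sup>2"
    using pos by (auto intro!: mult_le_square_mid power_strict_mono)
  then have "(\<alpha> * \<beta>) * (a * b) < \<eta>\<^sup>2 * h\<^sup>2"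
    using d pos by (intro mult_less_le_imp_less) auto
  then have "(\<alpha> * a) * (\<beta> * b) \<noteq> (\<eta> * h)\<^sup>2"
    by (simp add: power_mult_distrib mult_ac)
  moreover have "det A = of_real (\<alpha> * a)" "det B = of_real (\<beta> * b)" "det H = of_real (\<eta> * h)"
    using det_positive_definite_pivot[where k=k] pd d by (auto simp: \<alpha>_\<beta>_\<eta>_def)
  ultimately show ?thesis
    by (metis of_real_eq_iff of_real_mult of_real_power)
qed

text \<open>Where a nonnegative form vanishes it has a minimum, so its derivative in the direction \<open>y = x v* M\<close>, which is
  twice the square of the norm of \<open>y\<close>, must vanish.\<close>

lemma herm_form_minimum_kernel:
  fixes M :: "complex ^ 'n ^ 'n::finite"
  assumes H: "hermitian_matrix M" and nn: "\<And>x. herm_form M x \<ge> 0" and z: "herm_form M x = 0"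
  shows "x v* M = 0"
proof -
  define y where "y = x v* M"
  define c where "c = herm_form M y"
  have yj: "y $ j = (\<Sum>i\<in>UNIV. M $ i $ j * x $ i)" for j
    by (simp add: y_def vector_matrix_mult_def mult.commute)
  define N where "N = (\<Sum>j\<in>UNIV. (norm (y $ j))\<^sup>2)"
  have exp: "herm_form M (x + of_real t *s y) = 2 * t * N + t\<^sup>2 * c" for t
  proof -
    let ?S = "\<lambda>p q. (\<Sum>i\<in>UNIV. \<Sum>j\<in>UNIV. M $ i $ j * p $ i * cnj (q $ j))"
    have "?S (x + of_real t *s y) (x + of_real t *s y) =
        ?S x x + of_real t * ?S x y + of_real t * ?S y x + of_real (t\<^sup>2) * ?S y y"
      by (simp add: sum.distrib sum_distrib_left algebra_simps power2_eq_square)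
    moreover have "?S x y = of_real N"
    proof -
      have "?S x y = (\<Sum>j\<in>UNIV. \<Sum>i\<in>UNIV. M $ i $ j * x $ i * cnj (y $ j))"
        by (rule sum.swap)
      also have "\<dots> = (\<Sum>j\<in>UNIV. y $ j * cnj (y $ j))"
        by (simp add: yj sum_distrib_right)
      finally show ?thesis by (simp only: N_def of_real_sum complex_norm_square)
    qed
    moreover have "?S y x = cnj (?S x y)"
    proof -
      have "?S y x = (\<Sum>j\<in>UNIV. \<Sum>i\<in>UNIV. M $ i $ j * y $ i * cnj (x $ j))"
        by (rule sum.swap)
      also have "\<dots> = cnj (?S x y)"
        using H by (simp add: hermitian_matrix_cnj cnj_sum mult_ac)
      finally show ?thesis .
    qed
    ultimately show ?thesis using z by (simp add: herm_form_def c_def)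
  qed
  have N0: "N \<ge> 0" by (simp add: N_def sum_nonneg)
  have c0: "c \<ge> 0" using nn by (simp add: c_def)
  have "N = 0"
  proof (rule ccontr)
    assume "N \<noteq> 0"
    then have Np: "N > 0" using N0 by simp
    \<comment> \<open>A negative time so short that the linear term \<open>2 * t * N\<close> dominates.\<close>
    define t where "t = - N / (c + 1)"
    have "t < 0" using Np c0 by (simp add: t_def divide_neg_pos)
    have "2 * N + t * c > 0"
    proof -
      have "N * c \<le> N * (c + 1)" using Np by simp
      then have "N * c / (c + 1) \<le> N" using c0 by (simp add: pos_divide_le_eq)
      then show ?thesis using Np by (simp add: t_def)
    qed
    then have "t * (2 * N + t * c) < 0" using \<open>t < 0\<close> by (simp add: mult_neg_pos)
    moreover have "t * (2 * N + t * c) \<ge> 0"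
      using nn[of "x + of_real t *s y"] unfolding exp by (simp add: power2_eq_square algebra_simps)
    ultimately show False by simp
  qed
  then have "\<forall>j. y $ j = 0" by (simp add: N_def sum_nonneg_eq_0_iff)
  then show ?thesis unfolding y_def[symmetric] by (simp add: vec_eq_iff)
qed

lemma positive_definite_of_det:
  fixes M :: "complex ^ 'n ^ 'n::finite"
  assumes H: "hermitian_matrix M" and nn: "\<And>x. herm_form M x \<ge> 0" and d: "det M \<noteq> 0"
  shows "positive_definite M"
proof -
  have "herm_form M x \<noteq> 0" if "x \<noteq> 0" for x
  proof
    assume "herm_form M x = 0"
    then have "x v* M = 0" by (rule herm_form_minimum_kernel[OF H nn])
    then have "transpose M *v x = 0" by simp
    moreover have "invertible (transpose M)" using d by (simp add: invertible_det_nz)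
    ultimately show False
      using that by (metis inj_matrix_vector_mult injD matrix_vector_mult_0_right)
  qed
  then show ?thesis using H nn by (force simp: positive_definite_def less_le)
qed

section \<open>Calculus of functions of class \<open>C\<^sup>2\<close>\<close>

lemma pd_has_derivative:
  "f differentiable (at z) \<Longrightarrow> (f has_derivative (\<lambda>v. pd v f z)) (at z)"
  unfolding pd_def by (simp add: frechet_derivative_works[symmetric])

lemma pd_unique: "(f has_derivative f') (at z) \<Longrightarrow> pd v f z = f' v"
  unfolding pd_def using frechet_derivative_at by metis

lemma pd_Basis_sum:
  fixes f :: "'a::euclidean_space \<Rightarrow> 'b::real_normed_vector"
  assumes "f differentiable (at z)"
  shows "pd v f z = (\<Sum>b\<in>Basis. (v \<bullet> b) *\<^sub>R pd b f z)"
proof -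
  interpret bounded_linear "\<lambda>v. pd v f z"
    using pd_has_derivative[OF assms] by (rule has_derivative_bounded_linear)
  have "pd v f z = pd (\<Sum>b\<in>Basis. (v \<bullet> b) *\<^sub>R b) f z"
    by (simp add: euclidean_representation)
  also have "\<dots> = (\<Sum>b\<in>Basis. (v \<bullet> b) *\<^sub>R pd b f z)"
    by (simp add: sum scaleR)
  finally show ?thesis .
qed

lemma has_real_derivative_along_curve:
  fixes f :: "'a::real_normed_vector \<Rightarrow> real"
  assumes f: "f differentiable (at (\<gamma> r))" and \<gamma>: "(\<gamma> has_vector_derivative w) (at r)"
  shows "((\<lambda>r. f (\<gamma> r)) has_real_derivative pd w f (\<gamma> r)) (at r)"
proof -
  interpret bounded_linear "\<lambda>v. pd v f (\<gamma> r)"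
    using pd_has_derivative[OF f] by (rule has_derivative_bounded_linear)
  have "((\<lambda>r. f (\<gamma> r)) has_derivative (\<lambda>x. pd (x *\<^sub>R w) f (\<gamma> r))) (at r)"
    using has_derivative_compose[OF \<gamma>[unfolded has_vector_derivative_def] pd_has_derivative[OF f]] .
  then show ?thesis
    by (simp add: has_field_derivative_def scaleR mult_commute_abs)
qed

lemma has_real_derivative_along_line:
  fixes f :: "'a::real_normed_vector \<Rightarrow> real"
  assumes "f differentiable (at (p + r *\<^sub>R w))"
  shows "((\<lambda>r. f (p + r *\<^sub>R w)) has_real_derivative pd w f (p + r *\<^sub>R w)) (at r)"
proof -
  have "((\<lambda>r. p + r *\<^sub>R w) has_vector_derivative w) (at r)"
    by (auto intro!: derivative_eq_intros simp: has_vector_derivative_def)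
  then show ?thesis using has_real_derivative_along_curve[where \<gamma>="\<lambda>r. p + r *\<^sub>R w"] assms by blast
qed

text \<open>This form is bilinear in the two vectors at every point, whether or not \<open>u\<close> is differentiable there; at points
  where \<open>u\<close> is of class \<open>C\<^sup>2\<close> it agrees with iterated directional derivatives.\<close>

definition hessian :: "('a::euclidean_space \<Rightarrow> real) \<Rightarrow> 'a \<Rightarrow> 'a \<Rightarrow> 'a \<Rightarrow> real" where
  "hessian u z v w = (\<Sum>a\<in>Basis. \<Sum>b\<in>Basis. (v \<bullet> a) * (w \<bullet> b) * pd a (pd b u) z)"

lemma hessian_add_left: "hessian u z (v + v') w = hessian u z v w + hessian u z v' w"
  by (simp add: hessian_def inner_add_left algebra_simps sum.distrib)

lemma hessian_add_right: "hessian u z v (w + w') = hessian u z v w + hessian u z v w'"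
  by (simp add: hessian_def inner_add_left algebra_simps sum.distrib)

lemma hessian_scale_left: "hessian u z (c *\<^sub>R v) w = c * hessian u z v w"
  by (simp add: hessian_def sum_distrib_left mult_ac)

lemma hessian_scale_right: "hessian u z v (c *\<^sub>R w) = c * hessian u z v w"
  by (simp add: hessian_def sum_distrib_left mult_ac)

lemma hessian_diff_left: "hessian u z (v - v') w = hessian u z v w - hessian u z v' w"
  by (simp add: hessian_def inner_diff_left algebra_simps sum_subtractf)

lemma hessian_diff_right: "hessian u z v (w - w') = hessian u z v w - hessian u z v w'"
  by (simp add: hessian_def inner_diff_left algebra_simps sum_subtractf)

lemmas hessian_bilinear = hessian_add_left hessian_add_right hessian_scale_left
  hessian_scale_right hessian_diff_left hessian_diff_right

lemma Ck_on_Suc_imp_Ck_on: "Ck_on (Suc k) f S \<Longrightarrow> Ck_on k f S"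
proof (induction k arbitrary: f)
  case 0
  then show ?case
    by (auto intro!: differentiable_imp_continuous_on
        simp: differentiable_on_def differentiable_at_withinI)
next
  case (Suc k)
  then show ?case by simp
qed

locale C2_function =
  fixes u :: "'a::euclidean_space \<Rightarrow> real" and S :: "'a set"
  assumes open_S: "open S" and Ck_on_2: "Ck_on 2 u S"
begin

lemma differentiable_u: "z \<in> S \<Longrightarrow> u differentiable (at z)"
  using Ck_on_2 by (simp add: numeral_2_eq_2)

lemma differentiable_pd_Basis: "z \<in> S \<Longrightarrow> b \<in> Basis \<Longrightarrow> pd b u differentiable (at z)"
  using Ck_on_2 by (simp add: numeral_2_eq_2)

lemma continuous_pd2: "a \<in> Basis \<Longrightarrow> b \<in> Basis \<Longrightarrow> continuous_on S (pd a (pd b u))"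
  using Ck_on_2 by (simp add: numeral_2_eq_2)

lemma pd_u: "z \<in> S \<Longrightarrow> pd w u z = (\<Sum>b\<in>Basis. (w \<bullet> b) * pd b u z)"
  using pd_Basis_sum[OF differentiable_u] by simp

text \<open>Product rule for the derivative of \<open>u\<close> along a vector field \<open>X\<close>. Constant fields give the iterated
  directional derivatives; linear fields give the second derivative of \<open>u\<close> along a linear flow.\<close>

lemma has_derivative_pd_field:
  assumes z: "z \<in> S" and X: "\<And>b. b \<in> Basis \<Longrightarrow> ((\<lambda>y. X y \<bullet> b) has_derivative (\<lambda>v. X' v \<bullet> b)) (at z)"
  shows "((\<lambda>y. pd (X y) u y) has_derivative (\<lambda>v. pd (X' v) u z + hessian u z v (X z))) (at z)"
proof -
  have "((\<lambda>y. \<Sum>b\<in>Basis. (X y \<bullet> b) * pd b u y) has_derivative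
    (\<lambda>v. \<Sum>b\<in>Basis. (X z \<bullet> b) * pd v (pd b u) z + (X' v \<bullet> b) * pd b u z)) (at z)"
    by (intro has_derivative_sum has_derivative_mult X
        pd_has_derivative[OF differentiable_pd_Basis[OF z]])
  moreover have "(\<Sum>b\<in>Basis. (X z \<bullet> b) * pd v (pd b u) z + (X' v \<bullet> b) * pd b u z) =
    pd (X' v) u z + hessian u z v (X z)" for v
  proof -
    have "(\<Sum>b\<in>Basis. (X z \<bullet> b) * pd v (pd b u) z) = (\<Sum>b\<in>Basis. \<Sum>a\<in>Basis. (v \<bullet> a) * (X z \<bullet> b) * pd a (pd b u) z)"
      using differentiable_pd_Basis[OF z]
      by (intro sum.cong refl) (simp add: pd_Basis_sum[of _ z v] sum_distrib_left mult_ac)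
    also have "\<dots> = hessian u z v (X z)"
      unfolding hessian_def by (rule sum.swap)
    finally show ?thesis by (simp add: sum.distrib pd_u[OF z, of "X' v"])
  qed
  ultimately have "((\<lambda>y. \<Sum>b\<in>Basis. (X y \<bullet> b) * pd b u y) has_derivative
     (\<lambda>v. pd (X' v) u z + hessian u z v (X z))) (at z)"
    by simp
  then show ?thesis
    by (rule has_derivative_transform_within_open[OF _ open_S z]) (rule pd_u[symmetric])
qed

lemma
  assumes z: "z \<in> S"
  shows differentiable_pd: "pd w u differentiable (at z)"
    and pd_pd_u: "pd v (pd w u) z = hessian u z v w"
proof -
  have "(pd w u has_derivative (\<lambda>v. pd 0 u z + hessian u z v w)) (at z)"
    using has_derivative_pd_field[OF z, of "\<lambda>_. w" "\<lambda>_. 0"] by simp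
  then show "pd w u differentiable (at z)" "pd v (pd w u) z = hessian u z v w"
    using pd_unique[of _ _ z v] pd_u[OF z, of 0] unfolding differentiable_def by fastforce+
qed

lemma continuous_on_hessian:
  "continuous_on S (\<lambda>z. hessian u z v w)"
  unfolding hessian_def by (intro continuous_intros continuous_pd2)

text \<open>The mixed second difference is symmetric in \<open>v\<close> and \<open>w\<close>, whereas the order of differentiation on the right
  is fixed; this forces the symmetry of the Hessian below.\<close>

lemma second_difference_mean_value:
  assumes h: "h > 0" and inS: "\<And>s t. s \<in> {0..h} \<Longrightarrow> t \<in> {0..h} \<Longrightarrow> z + s *\<^sub>R v + t *\<^sub>R w \<in> S"
  obtains s t where "s \<in> {0..h}" "t \<in> {0..h}"
    "u (z + h *\<^sub>R v + h *\<^sub>R w) - u (z + h *\<^sub>R v) - u (z + h *\<^sub>R w) + u z =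
       h\<^sup>2 * hessian u (z + s *\<^sub>R v + t *\<^sub>R w) w v"
proof -
  have D: "((\<lambda>s. u (z + s *\<^sub>R v + h *\<^sub>R w) - u (z + s *\<^sub>R v)) has_real_derivative
      pd v u (z + s *\<^sub>R v + h *\<^sub>R w) - pd v u (z + s *\<^sub>R v)) (at s)" if "0 \<le> s" "s \<le> h" for s
  proof -
    have "z + h *\<^sub>R w + s *\<^sub>R v \<in> S" "z + s *\<^sub>R v \<in> S"
      using inS[of s h] inS[of s 0] that h by (auto simp: add_ac)
    then have "((\<lambda>s. u (z + h *\<^sub>R w + s *\<^sub>R v)) has_real_derivative pd v u (z + h *\<^sub>R w + s *\<^sub>R v)) (at s)"
      "((\<lambda>s. u (z + s *\<^sub>R v)) has_real_derivative pd v u (z + s *\<^sub>R v)) (at s)"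
      using has_real_derivative_along_line differentiable_u by blast+
    from DERIV_diff[OF this] show ?thesis by (simp add: add_ac)
  qed
  obtain s where s: "0 < s" "s < h" and es:
    "(u (z + h *\<^sub>R v + h *\<^sub>R w) - u (z + h *\<^sub>R v)) - (u (z + 0 *\<^sub>R v + h *\<^sub>R w) - u (z + 0 *\<^sub>R v)) =
     (h - 0) * (pd v u (z + s *\<^sub>R v + h *\<^sub>R w) - pd v u (z + s *\<^sub>R v))"
    using MVT2[OF h D] by blast
  have D2: "((\<lambda>t. pd v u (z + s *\<^sub>R v + t *\<^sub>R w)) has_real_derivative
      hessian u (z + s *\<^sub>R v + t *\<^sub>R w) w v) (at t)" if "0 \<le> t" "t \<le> h" for t
    using has_real_derivative_along_line[of "pd v u" "z + s *\<^sub>R v" t w] inS[of s t] s that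
    by (simp add: differentiable_pd pd_pd_u)
  obtain t where t: "0 < t" "t < h" and et:
    "pd v u (z + s *\<^sub>R v + h *\<^sub>R w) - pd v u (z + s *\<^sub>R v + 0 *\<^sub>R w) =
     (h - 0) * hessian u (z + s *\<^sub>R v + t *\<^sub>R w) w v"
    using MVT2[OF h D2] by blast
  show thesis
    using that[of s t] s t es et by (simp add: power2_eq_square algebra_simps)
qed

lemma hessian_sym:
  assumes z: "z \<in> S"
  shows "hessian u z v w = hessian u z w v"
proof (rule ccontr)
  assume neq: "hessian u z v w \<noteq> hessian u z w v"
  define \<eta> where "\<eta> = \<bar>hessian u z v w - hessian u z w v\<bar> / 2"
  have \<eta>: "\<eta> > 0" using neq by (simp add: \<eta>_def)
  have "\<forall>\<^sub>F y in at z. y \<in> S"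
    using eventually_at_topological open_S z by blast
  moreover have "\<forall>\<^sub>F y in at z. dist (hessian u y a b) (hessian u z a b) < \<eta>" for a b
  proof -
    have "isCont (\<lambda>y. hessian u y a b) z"
      using continuous_on_hessian[of a b] open_S z continuous_on_eq_continuous_at by blast
    then show ?thesis using \<eta> by (simp add: isCont_def tendsto_iff)
  qed
  ultimately have "\<forall>\<^sub>F y in at z. y \<in> S \<and> dist (hessian u y v w) (hessian u z v w) < \<eta> \<and>
     dist (hessian u y w v) (hessian u z w v) < \<eta>"
    by (intro eventually_conj) auto
  then obtain d where d: "d > 0" and near: "\<And>y. y \<noteq> z \<Longrightarrow> dist y z < d \<Longrightarrow> y \<in> S \<and>
     dist (hessian u y v w) (hessian u z v w) < \<eta> \<and> dist (hessian u y w v) (hessian u z w v) < \<eta>"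
    unfolding eventually_at by blast
  have near': "y \<in> S \<and> dist (hessian u y v w) (hessian u z v w) < \<eta> \<and>
      dist (hessian u y w v) (hessian u z w v) < \<eta>" if "dist y z < d" for y
    using near[of y] that z \<eta> by (cases "y = z") auto
  define h where "h = d / (norm v + norm w + 1)"
  have pos: "norm v + norm w + 1 > 0" by (smt (verit) norm_ge_zero)
  have h: "h > 0" using d pos by (simp add: h_def)
  have close: "dist (z + s *\<^sub>R v + t *\<^sub>R w) z < d" if "s \<in> {0..h}" "t \<in> {0..h}" for s t
  proof -
    have "dist (z + s *\<^sub>R v + t *\<^sub>R w) z = norm (s *\<^sub>R v + t *\<^sub>R w)"
      by (simp add: dist_norm)
    also have "\<dots> \<le> norm (s *\<^sub>R v) + norm (t *\<^sub>R w)" by (rule norm_triangle_ineq)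
    also have "\<dots> \<le> h * norm v + h * norm w"
      using that by (auto intro!: add_mono mult_right_mono)
    also have "\<dots> < h * (norm v + norm w + 1)" using h by (simp add: algebra_simps)
    also have "\<dots> = d" using pos by (simp add: h_def)
    finally show ?thesis .
  qed
  obtain s t where 1: "s \<in> {0..h}" "t \<in> {0..h}"
    "u (z + h *\<^sub>R v + h *\<^sub>R w) - u (z + h *\<^sub>R v) - u (z + h *\<^sub>R w) + u z =
       h\<^sup>2 * hessian u (z + s *\<^sub>R v + t *\<^sub>R w) w v"
    using second_difference_mean_value[OF h] close near' by metis
  have close': "z + s *\<^sub>R w + t *\<^sub>R v \<in> S" if "s \<in> {0..h}" "t \<in> {0..h}" for s t
    using close[of t s] near' that by (simp add: add_ac)
  obtain s' t' where 2: "s' \<in> {0..h}" "t' \<in> {0..h}"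
    "u (z + h *\<^sub>R w + h *\<^sub>R v) - u (z + h *\<^sub>R w) - u (z + h *\<^sub>R v) + u z =
       h\<^sup>2 * hessian u (z + s' *\<^sub>R w + t' *\<^sub>R v) v w"
    using second_difference_mean_value[of h z w v, OF h close'] by metis
  have comm: "z + h *\<^sub>R w + h *\<^sub>R v = z + h *\<^sub>R v + h *\<^sub>R w" by simp
  have "h\<^sup>2 * hessian u (z + s *\<^sub>R v + t *\<^sub>R w) w v = h\<^sup>2 * hessian u (z + s' *\<^sub>R w + t' *\<^sub>R v) v w"
    using 1(3) 2(3)[unfolded comm] by linarith
  then have eq: "hessian u (z + s *\<^sub>R v + t *\<^sub>R w) w v = hessian u (z + s' *\<^sub>R w + t' *\<^sub>R v) v w"
    using h by simp
  have "dist (hessian u (z + s *\<^sub>R v + t *\<^sub>R w) w v) (hessian u z w v) < \<eta>"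
    using near' close 1 by blast
  moreover have "dist (hessian u (z + s' *\<^sub>R w + t' *\<^sub>R v) v w) (hessian u z v w) < \<eta>"
    using near'[of "z + s' *\<^sub>R w + t' *\<^sub>R v"] close[of t' s'] 2 by (simp add: add_ac)
  ultimately show False
    using eq by (simp add: \<eta>_def dist_real_def abs_if split: if_splits)
qed

lemma taylor2:
  assumes "\<And>t. t \<in> {0..1} \<Longrightarrow> p + t *\<^sub>R w \<in> S"
  obtains t where "t \<in> {0..1}" "u (p + w) = u p + pd w u p + hessian u (p + t *\<^sub>R w) w w / 2"
proof -
  define diff where "diff = (\<lambda>m::nat. if m = 0 then (\<lambda>t. u (p + t *\<^sub>R w))
     else if m = 1 then (\<lambda>t. pd w u (p + t *\<^sub>R w)) else (\<lambda>t. hessian u (p + t *\<^sub>R w) w w))"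
  have "DERIV (diff m) t :> diff (Suc m) t" if "m < 2" "0 \<le> t" "t \<le> 1" for m t
  proof -
    have "p + t *\<^sub>R w \<in> S" using assms that by simp
    then have "((\<lambda>r. u (p + r *\<^sub>R w)) has_real_derivative pd w u (p + t *\<^sub>R w)) (at t)"
      "((\<lambda>r. pd w u (p + r *\<^sub>R w)) has_real_derivative hessian u (p + t *\<^sub>R w) w w) (at t)"
      using has_real_derivative_along_line differentiable_u differentiable_pd pd_pd_u by metis+
    then show ?thesis using that by (auto simp: diff_def less_2_cases_iff)
  qed
  then obtain t where t: "0 < t" "t < 1" and e:
    "u (p + 1 *\<^sub>R w) = (\<Sum>m<2. (diff m 0 / fact m) * 1 ^ m) + (diff 2 t / fact 2) * 1 ^ 2"
    using Maclaurin[of 1 2 diff "\<lambda>t. u (p + t *\<^sub>R w)"] by (auto simp: diff_def)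
  show thesis
    using that[of t] t e by (simp add: diff_def numeral_2_eq_2)
qed

lemma hessian_close:
  assumes z: "z \<in> S" and \<eta>: "\<eta> > 0"
  obtains d where "d > 0"
    "\<And>y v. dist y z < d \<Longrightarrow> y \<in> S \<and> \<bar>hessian u y v v - hessian u z v v\<bar> \<le> \<eta> * (norm v)\<^sup>2"
proof -
  define D where "D = (\<lambda>y. \<Sum>a\<in>Basis. \<Sum>b\<in>Basis. \<bar>pd a (pd b u) y - pd a (pd b u) z\<bar>)"
  have "continuous_on S D"
    unfolding D_def by (intro continuous_intros continuous_pd2)
  then have "isCont D z"
    using open_S z continuous_on_eq_continuous_at by blast
  moreover have "D z = 0" by (simp add: D_def)
  ultimately obtain d1 where d1: "d1 > 0" "\<And>y. dist y z < d1 \<Longrightarrow> dist (D y) 0 < \<eta>"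
    using \<eta> unfolding continuous_at_eps_delta by metis
  obtain d2 where d2: "d2 > 0" "\<And>y. dist y z < d2 \<Longrightarrow> y \<in> S"
    using open_S z unfolding open_dist by blast
  have "\<bar>hessian u y v v - hessian u z v v\<bar> \<le> \<eta> * (norm v)\<^sup>2" if "dist y z < d1" for y v
  proof -
    have "\<bar>hessian u y v v - hessian u z v v\<bar> =
      \<bar>\<Sum>a\<in>Basis. \<Sum>b\<in>Basis. (v \<bullet> a) * (v \<bullet> b) * (pd a (pd b u) y - pd a (pd b u) z)\<bar>"
      by (simp add: hessian_def sum_subtractf algebra_simps)
    also have "\<dots> \<le> (\<Sum>a\<in>Basis. \<Sum>b\<in>Basis. (norm v)\<^sup>2 * \<bar>pd a (pd b u) y - pd a (pd b u) z\<bar>)"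
    proof (intro order_trans[OF sum_abs] sum_mono)
      fix a b :: 'a assume ab: "a \<in> Basis" "b \<in> Basis"
      have "\<bar>v \<bullet> a\<bar> * \<bar>v \<bullet> b\<bar> \<le> norm v * norm v"
        using ab by (intro mult_mono Basis_le_norm) auto
      then show "\<bar>(v \<bullet> a) * (v \<bullet> b) * (pd a (pd b u) y - pd a (pd b u) z)\<bar> \<le>
        (norm v)\<^sup>2 * \<bar>pd a (pd b u) y - pd a (pd b u) z\<bar>"
        by (simp add: abs_mult power2_eq_square mult_right_mono)
    qed
    also have "\<dots> = (norm v)\<^sup>2 * D y" by (simp add: D_def sum_distrib_left)
    also have "\<dots> \<le> (norm v)\<^sup>2 * \<eta>"
      using d1(2)[OF that] by (intro mult_left_mono) (auto simp: dist_real_def)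
    finally show ?thesis by (simp add: mult.commute)
  qed
  then show thesis using that[of "min d1 d2"] d1 d2 by simp
qed

end

lemma local_max_second_derivative:
  fixes g :: "real \<Rightarrow> real"
  assumes e: "e > 0" and g: "\<And>r. \<bar>r\<bar> < e \<Longrightarrow> (g has_real_derivative g' r) (at r)"
    and g': "(g' has_real_derivative D) (at 0)" and max: "\<And>r. \<bar>r\<bar> < e \<Longrightarrow> g r \<le> g 0"
  shows "D \<le> 0"
proof (rule ccontr)
  assume "\<not> D \<le> 0"
  then obtain d where d: "d > 0" "\<And>h. 0 < h \<Longrightarrow> h < d \<Longrightarrow> g' 0 < g' h"
    using DERIV_pos_inc_right[OF g'] by fastforce
  have g0: "g' 0 = 0"
    using DERIV_local_max[OF g[of 0] e] e max by simp
  define h where "h = min d e / 2"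
  have h: "0 < h" "h < d" "h < e" using d e by (auto simp: h_def)
  have "\<exists>z>0. z < h \<and> g h - g 0 = (h - 0) * g' z"
    using h by (intro MVT2 g) auto
  then obtain z where "0 < z" "z < h" "g h - g 0 = h * g' z" by auto
  then have "g h - g 0 > 0" using d(2)[of z] h g0 by simp
  then show False using max[of h] h by simp
qed

lemma sum_Basis_complex_vec:
  fixes f :: "complex ^ 'n::finite \<Rightarrow> 'b::comm_monoid_add"
  shows "(\<Sum>b\<in>Basis. f b) = (\<Sum>i\<in>UNIV. f (axis i 1) + f (axis i \<i>))"
proof -
  have B: "(Basis :: (complex ^ 'n) set) = (\<lambda>(i, c). axis i c) ` (UNIV \<times> {1, \<i>})"
    by (auto simp: Basis_vec_def Basis_complex_def)
  have "inj_on (\<lambda>(i, c). axis i c :: complex ^ 'n) (UNIV \<times> {1, \<i>})"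
    by (auto simp: inj_on_def axis_eq_axis)
  then have "(\<Sum>b\<in>Basis. f b) = (\<Sum>(i, c)\<in>UNIV \<times> {1, \<i>}. f (axis i c))"
    unfolding B by (subst sum.reindex) (auto simp: case_prod_unfold o_def)
  also have "\<dots> = (\<Sum>i\<in>UNIV. \<Sum>c\<in>{1, \<i>}. f (axis i c))"
    by (rule sum.cartesian_product[symmetric])
  finally show ?thesis by simp
qed

lemma inner_axis_1: "(w :: complex ^ 'n::finite) \<bullet> axis i 1 = Re (w $ i)"
  and inner_axis_ii: "(w :: complex ^ 'n::finite) \<bullet> axis i \<i> = Im (w $ i)"
  by (simp_all add: inner_axis inner_complex_def)

section \<open>Complex Hessian and plurisubharmonicity\<close>

definition levi_form :: "(complex ^ 'n::finite \<Rightarrow> real) \<Rightarrow> complex ^ 'n \<Rightarrow> complex ^ 'n \<Rightarrow> real" where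
  "levi_form u z w = hessian u z w w + hessian u z (\<i> *s w) (\<i> *s w)"

lemma complex_hessian_entry:
  fixes u :: "complex ^ 'n::finite \<Rightarrow> real"
  assumes "C2_function u S" and z: "z \<in> S"
  shows "complex_hessian u z $ i $ j =
      Complex (hessian u z (axis i 1) (axis j 1) + hessian u z (axis i \<i>) (axis j \<i>))
        (hessian u z (axis i 1) (axis j \<i>) - hessian u z (axis i \<i>) (axis j 1)) / 4"
proof -
  interpret C2_function u S by fact
  have pd_cor: "pd v (\<lambda>w. complex_of_real (u w)) y = of_real (pd v u y)" if "y \<in> S" for v y
    by (rule pd_unique[OF has_derivative_of_real[OF pd_has_derivative[OF differentiable_u[OF that]]]])
  have "((\<lambda>y. (of_real (pd (axis j 1) u y) + \<i> * of_real (pd (axis j \<i>) u y)) / 2) has_derivative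
     (\<lambda>v. (of_real (pd v (pd (axis j 1) u) z) + \<i> * of_real (pd v (pd (axis j \<i>) u) z)) / 2)) (at z)"
    using z by (auto intro!: derivative_eq_intros pd_has_derivative differentiable_pd simp: scaleR_conv_of_real)
  then have "((\<lambda>y. d_zbar j (\<lambda>w. complex_of_real (u w)) y) has_derivative
     (\<lambda>v. (of_real (pd v (pd (axis j 1) u) z) + \<i> * of_real (pd v (pd (axis j \<i>) u) z)) / 2)) (at z)"
    by (rule has_derivative_transform_within_open[OF _ open_S z]) (simp add: d_zbar_def pd_cor)
  from pd_unique[OF this] have D: "pd v (d_zbar j (\<lambda>w. complex_of_real (u w))) z =
     (of_real (hessian u z v (axis j 1)) + \<i> * of_real (hessian u z v (axis j \<i>))) / 2" for v
    using z by (simp add: pd_pd_u)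
  then show ?thesis
    by (simp add: complex_hessian_def d_z_def D complex_eq_iff)
qed

lemma hermitian_complex_hessian:
  assumes "C2_function u S" and "z \<in> S"
  shows "hermitian_matrix (complex_hessian u z)"
  unfolding hermitian_matrix_def complex_hessian_entry[OF assms]
  using C2_function.hessian_sym[OF assms] by (simp add: complex_eq_iff)

lemma levi_form_eq_herm_form:
  assumes "C2_function u S" and z: "z \<in> S"
  shows "levi_form u z w = 4 * herm_form (complex_hessian u z) w"
proof -
  interpret C2_function u S by fact
  let ?h = "\<lambda>v w. hessian u z v w"
  have h: "pd v (pd w u) z = ?h v w" for v w by (rule pd_pd_u[OF z])
  have H: "hessian u z v v = (\<Sum>i\<in>UNIV. \<Sum>j\<in>UNIV.
      Re (v $ i) * Re (v $ j) * ?h (axis i 1) (axis j 1) + Re (v $ i) * Im (v $ j) * ?h (axis i 1) (axis j \<i>)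
      + Im (v $ i) * Re (v $ j) * ?h (axis i \<i>) (axis j 1) + Im (v $ i) * Im (v $ j) * ?h (axis i \<i>) (axis j \<i>))" for v
    by (subst hessian_def, simp only: sum_Basis_complex_vec inner_axis_1 inner_axis_ii h)
      (simp add: sum.distrib algebra_simps)
  show ?thesis
    unfolding levi_form_def herm_form_def H sum.distrib[symmetric] Re_sum sum_distrib_left
    by (intro sum.cong refl) (simp add: complex_hessian_entry[OF assms] algebra_simps)
qed

lemma cis_scale_vec: "cis t *s w = cos t *\<^sub>R w + sin t *\<^sub>R (\<i> *s (w :: complex ^ 'n))"
  by (simp add: vec_eq_iff complex_eq_iff)

lemma norm_vector_scalar_mult: "norm (c *s (w :: complex ^ 'n::finite)) = norm c * norm w"
  by (simp add: norm_vec_def L2_set_def norm_mult power_mult_distrib sum_distrib_left[symmetric]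
      real_sqrt_mult)

text \<open>On a small circle around \<open>z\<close> in the complex direction \<open>w\<close>, the Taylor expansion bounds \<open>u\<close> by a
  trigonometric polynomial of degree two up to a small multiple of the squared radius. Its mean exceeds \<open>u z\<close>
  by a quarter of the Levi form and by that small error, so a negative Levi form contradicts the sub-mean
  value inequality.\<close>

lemma plurisubharmonic_imp_levi_form_nonneg:
  assumes "C2_function u S" and psh: "plurisubharmonic_on u S" and z: "z \<in> S"
  shows "levi_form u z w \<ge> 0"
proof (rule ccontr)
  interpret C2_function u S by fact
  assume "\<not> levi_form u z w \<ge> 0"
  then have neg: "levi_form u z w < 0" by simp
  then have "w \<noteq> 0" by (auto simp: levi_form_def hessian_def)
  then have nw: "norm w > 0" by simp
  \<comment> \<open>The error term then cancels only half of the quadratic term.\<close>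
  define \<eta> where "\<eta> = - levi_form u z w / (4 * (norm w)\<^sup>2)"
  have \<eta>: "\<eta> > 0" using neg nw by (simp add: \<eta>_def divide_neg_pos)
  obtain d where d: "d > 0" and near:
    "\<And>y v. dist y z < d \<Longrightarrow> y \<in> S \<and> \<bar>hessian u y v v - hessian u z v v\<bar> \<le> \<eta> * (norm v)\<^sup>2"
    using hessian_close[OF z \<eta>] by metis
  define r where "r = d / (2 * norm w)"
  have r: "r > 0" using d nw by (simp add: r_def)
  define x where "x = r *\<^sub>R w"
  have nx: "norm x = d / 2" using r nw d by (simp add: x_def r_def)
  have disc: "dist (z + \<zeta> *s x) z < d" if "norm \<zeta> \<le> 1" for \<zeta>
  proof -
    have "dist (z + \<zeta> *s x) z = norm \<zeta> * norm x" by (simp add: dist_norm norm_vector_scalar_mult)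
    also have "\<dots> \<le> 1 * norm x" using that by (intro mult_right_mono) auto
    also have "\<dots> < d" using nx d by simp
    finally show ?thesis .
  qed
  define a1 a2 where "a1 = pd x u z" and "a2 = pd (\<i> *s x) u z"
  have lin: "bounded_linear (\<lambda>v. pd v u z)"
    using pd_has_derivative[OF differentiable_u[OF z]] by (rule has_derivative_bounded_linear)
  define h11 h12 h22 where "h11 = hessian u z x x" and
    "h12 = hessian u z x (\<i> *s x) + hessian u z (\<i> *s x) x" and
    "h22 = hessian u z (\<i> *s x) (\<i> *s x)"
  define q where "q = (\<lambda>t. u z + (cos t * a1 + sin t * a2) + ((cos t)\<^sup>2 * h11 + cos t * sin t * h12
       + (sin t)\<^sup>2 * h22 + \<eta> * (norm x)\<^sup>2) / 2)"
  have bound: "u (z + cis t *s x) \<le> q t" for t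
  proof -
    let ?v = "cis t *s x"
    have seg: "dist (z + s *\<^sub>R ?v) z < d" if "s \<in> {0..1}" for s
    proof -
      have "s *\<^sub>R ?v = (of_real s * cis t) *s x" by (simp add: vec_eq_iff complex_eq_iff algebra_simps)
      moreover have "norm (of_real s * cis t) \<le> 1" using that by (simp add: norm_mult)
      ultimately show ?thesis using disc by metis
    qed
    obtain s where s: "s \<in> {0..1}" "u (z + ?v) = u z + pd ?v u z + hessian u (z + s *\<^sub>R ?v) ?v ?v / 2"
      using taylor2[of z ?v] seg near by metis
    have "hessian u (z + s *\<^sub>R ?v) ?v ?v \<le> hessian u z ?v ?v + \<eta> * (norm ?v)\<^sup>2"
      using near[OF seg[OF s(1)], of ?v] by linarith
    moreover have "norm ?v = norm x" by (simp add: norm_vector_scalar_mult)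
    moreover have "hessian u z ?v ?v = (cos t)\<^sup>2 * h11 + cos t * sin t * h12 + (sin t)\<^sup>2 * h22"
      by (simp add: cis_scale_vec hessian_bilinear h11_def h12_def h22_def power2_eq_square algebra_simps)
    moreover have "pd ?v u z = cos t * a1 + sin t * a2"
      using linear_add[OF bounded_linear.linear[OF lin]] linear_scale[OF bounded_linear.linear[OF lin]]
      by (simp add: cis_scale_vec a1_def a2_def)
    ultimately show ?thesis using s(2) by (simp add: q_def)
  qed
  have mean: "(\<lambda>t. u (z + cis t *s x)) integrable_on {0..2 * pi}"
    "u z \<le> 1 / (2 * pi) * integral {0..2 * pi} (\<lambda>t. u (z + cis t *s x))"
    using psh near disc unfolding plurisubharmonic_on_def by metis+
  \<comment> \<open>An antiderivative of \<open>q\<close>, to evaluate the mean of the trigonometric polynomial.\<close>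
  define Q where "Q = (\<lambda>t. u z * t + (sin t * a1 - cos t * a2) + ((t + sin t * cos t) / 2 * h11
     + (sin t)\<^sup>2 / 2 * h12 + (t - sin t * cos t) / 2 * h22 + \<eta> * (norm x)\<^sup>2 * t) / 2)"
  have "(Q has_real_derivative q t) (at t)" for t
  proof -
    have "(Q has_real_derivative u z + (cos t * a1 + sin t * a2) +
       ((1 + (cos t * cos t - sin t * sin t)) / 2 * h11 + sin t * cos t * h12
       + (1 - (cos t * cos t - sin t * sin t)) / 2 * h22 + \<eta> * (norm x)\<^sup>2) / 2) (at t)"
      unfolding Q_def by (auto intro!: derivative_eq_intros simp: field_simps)
    moreover have "(1 + (cos t * cos t - sin t * sin t)) / 2 = (cos t)\<^sup>2"
      using sin_cos_squared_add3[of t] unfolding power2_eq_square by argo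
    moreover have "(1 - (cos t * cos t - sin t * sin t)) / 2 = (sin t)\<^sup>2"
      using sin_cos_squared_add3[of t] unfolding power2_eq_square by argo
    ultimately show ?thesis by (simp add: q_def mult_ac)
  qed
  then have "(q has_integral (Q (2 * pi) - Q 0)) {0..2 * pi}"
    by (intro fundamental_theorem_of_calculus)
      (auto simp: has_real_derivative_iff_has_vector_derivative[symmetric] has_field_derivative_at_within)
  then have int: "q integrable_on {0..2 * pi}" "integral {0..2 * pi} q = Q (2 * pi) - Q 0"
    by (auto simp: has_integral_integrable integral_unique)
  have "u z * (2 * pi) \<le> integral {0..2 * pi} (\<lambda>t. u (z + cis t *s x))"
    using mean(2) by (simp add: field_simps)
  also have "\<dots> \<le> integral {0..2 * pi} q"
    using bound mean(1) int(1) by (intro integral_le) auto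
  also have "\<dots> = u z * (2 * pi) + pi * ((h11 + h22) / 2 + \<eta> * (norm x)\<^sup>2)"
    unfolding int(2) by (simp add: Q_def field_simps)
  finally have "0 \<le> (h11 + h22) / 2 + \<eta> * (norm x)\<^sup>2"
    using pi_gt_zero by (simp add: zero_le_mult_iff)
  moreover have "h11 + h22 = r\<^sup>2 * levi_form u z w"
  proof -
    have "\<i> *s x = r *\<^sub>R (\<i> *s w)" by (simp add: x_def vec_eq_iff)
    then show ?thesis
      by (simp add: h11_def h22_def levi_form_def x_def hessian_bilinear power2_eq_square algebra_simps)
  qed
  moreover have "\<eta> * (norm x)\<^sup>2 = - r\<^sup>2 * levi_form u z w / 4"
    using nw r by (simp add: \<eta>_def x_def power_mult_distrib)
  ultimately have "0 \<le> r\<^sup>2 * levi_form u z w" by argo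
  then show False using neg r by (simp add: zero_le_mult_iff)
qed

lemma positive_definite_complex_hessian:
  assumes "C2_function u S" "plurisubharmonic_on u S" "z \<in> S" "det (complex_hessian u z) \<noteq> 0"
  shows "positive_definite (complex_hessian u z)"
  using plurisubharmonic_imp_levi_form_nonneg[OF assms(1,2,3)] assms
    levi_form_eq_herm_form[OF assms(1,3)]
  by (intro positive_definite_of_det hermitian_complex_hessian) auto

section \<open>The maximum principle along linear flows\<close>

definition congruence :: "complex ^ 'n ^ 'n \<Rightarrow> complex ^ 'n ^ 'n \<Rightarrow> complex ^ 'n ^ 'n::finite" where
  "congruence G M = transpose G ** M ** (\<chi> i j. cnj (G $ i $ j))"

lemma congruence_nth:
  "congruence G M $ i $ j = (\<Sum>a\<in>UNIV. \<Sum>b\<in>UNIV. G $ a $ i * M $ a $ b * cnj (G $ b $ j))"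
  unfolding congruence_def matrix_matrix_mult_def transpose_def
  by (simp add: sum_distrib_right) (rule sum.swap)

lemma det_cnj: "det (\<chi> i j. cnj (G $ i $ j)) = cnj (det (G :: complex ^ 'n ^ 'n::finite))"
proof -
  have "cnj (of_int k) = of_int k" for k by (metis Reals_cnj_iff Reals_of_int)
  then show ?thesis by (simp add: det_def cnj_sum cnj_prod)
qed

lemma det_congruence: "det (congruence G M) = det G * det M * cnj (det G)"
  by (simp add: congruence_def det_mul det_cnj)

lemma herm_form_congruence: "herm_form (congruence G M) x = herm_form M (G *v x)"
proof -
  have "(\<Sum>i\<in>UNIV. \<Sum>j\<in>UNIV. congruence G M $ i $ j * x $ i * cnj (x $ j)) =
     (\<Sum>i\<in>UNIV. \<Sum>j\<in>UNIV. \<Sum>a\<in>UNIV. \<Sum>b\<in>UNIV.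
        M $ a $ b * (G $ a $ i * x $ i) * (cnj (G $ b $ j) * cnj (x $ j)))"
    by (simp add: congruence_nth sum_distrib_left sum_distrib_right mult_ac)
  also have "\<dots> = (\<Sum>i\<in>UNIV. \<Sum>a\<in>UNIV. \<Sum>j\<in>UNIV. \<Sum>b\<in>UNIV.
        M $ a $ b * (G $ a $ i * x $ i) * (cnj (G $ b $ j) * cnj (x $ j)))"
    by (intro sum.cong refl sum.swap)
  also have "\<dots> = (\<Sum>a\<in>UNIV. \<Sum>i\<in>UNIV. \<Sum>j\<in>UNIV. \<Sum>b\<in>UNIV.
        M $ a $ b * (G $ a $ i * x $ i) * (cnj (G $ b $ j) * cnj (x $ j)))"
    by (rule sum.swap)
  also have "\<dots> = (\<Sum>a\<in>UNIV. \<Sum>i\<in>UNIV. \<Sum>b\<in>UNIV. \<Sum>j\<in>UNIV.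
        M $ a $ b * (G $ a $ i * x $ i) * (cnj (G $ b $ j) * cnj (x $ j)))"
    by (intro sum.cong refl sum.swap)
  also have "\<dots> = (\<Sum>a\<in>UNIV. \<Sum>b\<in>UNIV. \<Sum>i\<in>UNIV. \<Sum>j\<in>UNIV.
        M $ a $ b * (G $ a $ i * x $ i) * (cnj (G $ b $ j) * cnj (x $ j)))"
    by (intro sum.cong refl sum.swap)
  also have "\<dots> = (\<Sum>a\<in>UNIV. \<Sum>b\<in>UNIV. M $ a $ b * (G *v x) $ a * cnj ((G *v x) $ b))"
    by (simp add: matrix_vector_mult_def cnj_sum sum_distrib_left sum_distrib_right mult_ac)
  finally show ?thesis by (simp add: herm_form_def)
qed

lemma positive_definite_congruence:
  fixes G M :: "complex ^ 'n ^ 'n::finite"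
  assumes "positive_definite M" "det G \<noteq> 0"
  shows "positive_definite (congruence G M)"
proof -
  have H: "hermitian_matrix M" using assms by (simp add: positive_definite_def)
  have "hermitian_matrix (congruence G M)"
    unfolding hermitian_matrix_def congruence_nth
  proof (intro allI)
    fix i j
    have "(\<Sum>a\<in>UNIV. \<Sum>b\<in>UNIV. G $ a $ j * M $ a $ b * cnj (G $ b $ i)) =
      (\<Sum>b\<in>UNIV. \<Sum>a\<in>UNIV. G $ a $ j * M $ a $ b * cnj (G $ b $ i))"
      by (rule sum.swap)
    then show "(\<Sum>a\<in>UNIV. \<Sum>b\<in>UNIV. G $ a $ j * M $ a $ b * cnj (G $ b $ i)) =
       cnj (\<Sum>a\<in>UNIV. \<Sum>b\<in>UNIV. G $ a $ i * M $ a $ b * cnj (G $ b $ j))"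
      using H by (simp add: cnj_sum hermitian_matrix_cnj mult_ac)
  qed
  moreover have "inj ((*v) G)"
    using assms(2) by (simp add: inj_matrix_vector_mult invertible_det_nz)
  then have "G *v x \<noteq> 0" if "x \<noteq> 0" for x
    using that injD[of "(*v) G" x 0] by auto
  ultimately show ?thesis
    using assms(1) unfolding positive_definite_def herm_form_congruence by blast
qed

lemma (in C2_function) line_in_S:
  assumes "p \<in> S"
  obtains e where "e > 0" "\<And>r::real. \<bar>r\<bar> < e \<Longrightarrow> p + r *\<^sub>R w \<in> S"
proof -
  have "open ((\<lambda>r::real. p + r *\<^sub>R w) -` S)"
    using open_S by (intro continuous_open_vimage continuous_intros)
  moreover have "0 \<in> (\<lambda>r::real. p + r *\<^sub>R w) -` S" using assms by simp
  ultimately obtain e where "e > 0" "ball 0 e \<subseteq> (\<lambda>r::real. p + r *\<^sub>R w) -` S"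
    using open_contains_ball by blast
  then show thesis by (intro that[of e]) (auto simp: dist_real_def)
qed

lemma (in C2_function) second_derivative_at_local_max:
  assumes in_S: "p \<in> S" "a \<in> S" "b \<in> S" and e: "e > 0"
    and max: "\<And>r. \<bar>r\<bar> < e \<Longrightarrow>
      u (a + r *\<^sub>R x) + u (b + r *\<^sub>R y) - 2 * u (p + r *\<^sub>R w) + c * (norm (p + r *\<^sub>R w))\<^sup>2
      \<le> u a + u b - 2 * u p + c * (norm p)\<^sup>2"
  shows "hessian u a x x + hessian u b y y + 2 * c * (norm w)\<^sup>2 \<le> 2 * hessian u p w w"
proof -
  obtain e1 where e1: "e1 > 0" "\<And>r. \<bar>r\<bar> < e1 \<Longrightarrow> a + r *\<^sub>R x \<in> S" using line_in_S in_S by metis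
  obtain e2 where e2: "e2 > 0" "\<And>r. \<bar>r\<bar> < e2 \<Longrightarrow> b + r *\<^sub>R y \<in> S" using line_in_S in_S by metis
  obtain e3 where e3: "e3 > 0" "\<And>r. \<bar>r\<bar> < e3 \<Longrightarrow> p + r *\<^sub>R w \<in> S" using line_in_S in_S by metis
  define e' where "e' = Min {e, e1, e2, e3}"
  have e': "e' > 0" "e' \<le> e" "e' \<le> e1" "e' \<le> e2" "e' \<le> e3"
    using e e1 e2 e3 by (auto simp: e'_def)
  define g where "g = (\<lambda>r. u (a + r *\<^sub>R x) + u (b + r *\<^sub>R y) - 2 * u (p + r *\<^sub>R w)
      + c * ((norm p)\<^sup>2 + 2 * r * (p \<bullet> w) + r\<^sup>2 * (norm w)\<^sup>2))"
  define g' where "g' = (\<lambda>r. pd x u (a + r *\<^sub>R x) + pd y u (b + r *\<^sub>R y) - 2 * pd w u (p + r *\<^sub>R w)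
      + c * (2 * (p \<bullet> w) + 2 * r * (norm w)\<^sup>2))"
  have sq: "(norm (p + r *\<^sub>R w))\<^sup>2 = (norm p)\<^sup>2 + 2 * r * (p \<bullet> w) + r\<^sup>2 * (norm w)\<^sup>2" for r
    unfolding power2_norm_eq_inner
    by (simp add: inner_simps inner_commute[of w p] power2_eq_square algebra_simps)
  have "(g has_real_derivative g' r) (at r)" if "\<bar>r\<bar> < e'" for r
    unfolding g_def g'_def
    using that e' e1(2)[of r] e2(2)[of r] e3(2)[of r]
    by (auto intro!: derivative_eq_intros has_real_derivative_along_line differentiable_u)
  moreover have "(g' has_real_derivative (hessian u a x x + hessian u b y y - 2 * hessian u p w w
      + 2 * c * (norm w)\<^sup>2)) (at 0)"
  proof -
    have "((\<lambda>r. pd v u (q + r *\<^sub>R v)) has_real_derivative hessian u q v v) (at 0)" if "q \<in> S" for q v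
      using has_real_derivative_along_line[of "pd v u" q 0 v] that
      by (simp add: differentiable_pd pd_pd_u)
    then show ?thesis
      unfolding g'_def using in_S by (auto intro!: derivative_eq_intros)
  qed
  moreover have "g r \<le> g 0" if "\<bar>r\<bar> < e'" for r
    using max[of r] that e' by (simp add: g_def sq)
  ultimately have "hessian u a x x + hessian u b y y - 2 * hessian u p w w + 2 * c * (norm w)\<^sup>2 \<le> 0"
    by (rule local_max_second_derivative[OF e'(1)])
  then show ?thesis by linarith
qed

text \<open>At a local maximum the second derivatives in the complex directions give, for the complex Hessians \<open>A\<close>, \<open>B\<close>,
  \<open>H\<close> of \<open>u \<circ> G1\<close>, \<open>u \<circ> G2\<close> and \<open>u\<close>, the strict inequality \<open>A + B < 2 H\<close>. But \<open>det A * det B = (det H)\<^sup>2\<close>,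
  since the complex Hessian of \<open>u\<close> has constant determinant and \<open>G1\<close>, \<open>G2\<close> are inverse to each other.
  This contradicts \<open>det_mid_less\<close>.\<close>

lemma no_local_max_of_composition:
  fixes u :: "complex ^ 'n::finite \<Rightarrow> real" and G1 G2 :: "complex ^ 'n ^ 'n"
  assumes C2: "C2_function u S" and psh: "plurisubharmonic_on u S"
    and ma: "\<And>z. z \<in> S \<Longrightarrow> det (complex_hessian u z) = d" "d \<noteq> 0"
    and in_S: "p \<in> S" "G1 *v p \<in> S" "G2 *v p \<in> S"
    and inv: "G2 ** G1 = mat 1" and c: "c > 0" and e: "e > 0"
  defines "f \<equiv> \<lambda>y. u (G1 *v y) + u (G2 *v y) - 2 * u y + c * (norm y)\<^sup>2"
  shows "\<exists>y. dist y p < e \<and> f p < f y"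
proof (rule ccontr)
  interpret C2_function u S by fact
  assume "\<not> ?thesis"
  then have max: "f y \<le> f p" if "dist y p < e" for y using that by force
  have H: "hessian u (G1 *v p) (G1 *v w) (G1 *v w) + hessian u (G2 *v p) (G2 *v w) (G2 *v w)
    + 2 * c * (norm w)\<^sup>2 \<le> 2 * hessian u p w w" for w
  proof (rule second_derivative_at_local_max[OF in_S])
    define e' where "e' = e / (norm w + 1)"
    have pos: "norm w + 1 > 0" by (smt (verit) norm_ge_zero)
    show "e' > 0" using e pos by (simp add: e'_def)
    fix r :: real assume r: "\<bar>r\<bar> < e'"
    have "dist (p + r *\<^sub>R w) p = \<bar>r\<bar> * norm w" by (simp add: dist_norm)
    also have "\<dots> \<le> \<bar>r\<bar> * (norm w + 1)" by (simp add: mult_left_mono)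
    also have "\<dots> < e' * (norm w + 1)" using r pos by simp
    also have "\<dots> = e" using pos by (simp add: e'_def)
    finally have "f (p + r *\<^sub>R w) \<le> f p" by (rule max)
    moreover have "G *v (p + r *\<^sub>R w) = G *v p + r *\<^sub>R (G *v w)" for G :: "complex ^ 'n ^ 'n"
      by (simp add: linear_add linear_scale)
    ultimately show "u (G1 *v p + r *\<^sub>R (G1 *v w)) + u (G2 *v p + r *\<^sub>R (G2 *v w)) - 2 * u (p + r *\<^sub>R w)
      + c * (norm (p + r *\<^sub>R w))\<^sup>2 \<le> u (G1 *v p) + u (G2 *v p) - 2 * u p + c * (norm p)\<^sup>2"
      by (simp add: f_def)
  qed
  have "G *v (\<i> *s w) = \<i> *s (G *v w)" for w and G :: "complex ^ 'n ^ 'n"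
    by (simp add: matrix_vector_mult_def vec_eq_iff sum_distrib_left mult_ac)
  then have L: "levi_form u (G1 *v p) (G1 *v w) + levi_form u (G2 *v p) (G2 *v w)
    + 4 * c * (norm w)\<^sup>2 \<le> 2 * levi_form u p w" for w
    using H[of w] H[of "\<i> *s w"] by (simp add: levi_form_def norm_vector_scalar_mult)
  let ?A = "congruence G1 (complex_hessian u (G1 *v p))"
  let ?B = "congruence G2 (complex_hessian u (G2 *v p))"
  let ?H = "complex_hessian u p"
  have dd: "det G2 * det G1 = 1"
    using inv by (metis det_I det_mul)
  then have nz: "det G1 \<noteq> 0" "det G2 \<noteq> 0" by auto
  have pd: "positive_definite (complex_hessian u z)" if "z \<in> S" for z
    using positive_definite_complex_hessian[OF C2 psh that] ma that by simp
  have "det ?A * det ?B \<noteq> (det ?H)\<^sup>2"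
  proof (rule det_mid_less)
    show "positive_definite ?A" "positive_definite ?B" "positive_definite ?H"
      using pd in_S nz by (auto intro: positive_definite_congruence)
    show "herm_form ?A x + herm_form ?B x < 2 * herm_form ?H x" if "x \<noteq> 0" for x
    proof -
      have "c * (norm x)\<^sup>2 > 0" using c that by simp
      then show ?thesis
        using L[of x] in_S
        by (simp add: herm_form_congruence levi_form_eq_herm_form[OF C2])
    qed
  qed
  moreover have "det ?A * det ?B = (det G2 * det G1) * cnj (det G2 * det G1) * d\<^sup>2"
    using ma in_S by (simp add: det_congruence power2_eq_square)
  ultimately show False using ma in_S dd by simp
qed

text \<open>The second derivative at time \<open>0\<close> of \<open>u\<close> along the trajectory of the linear field \<open>z \<mapsto> M *v z\<close>
  through \<open>z\<close>.\<close>

definition flow_second_derivative ::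
    "complex ^ 'n ^ 'n \<Rightarrow> (complex ^ 'n::finite \<Rightarrow> real) \<Rightarrow> complex ^ 'n \<Rightarrow> real" where
  "flow_second_derivative M u z = pd (M *v (M *v z)) u z + hessian u z (M *v z) (M *v z)"

text \<open>The one-parameter group \<open>G s = exp(s M)\<close>, through those of its properties that the maximum principle uses.\<close>

locale linear_flow =
  fixes G :: "real \<Rightarrow> complex ^ 'n ^ 'n::finite" and M :: "complex ^ 'n ^ 'n"
  assumes flow_0: "G 0 = mat 1"
    and flow_deriv: "((\<lambda>s. G s *v z) has_vector_derivative M *v (G s *v z)) (at s)"
    and flow_cont: "continuous_on UNIV (\<lambda>(s, z). G s *v z)"
    and flow_inverse: "G (- s) ** G s = mat 1"
begin

lemma second_difference_quotient:
  assumes "C2_function u S" and h: "h > 0" and in_S: "\<And>s. \<bar>s\<bar> \<le> h \<Longrightarrow> G s *v z \<in> S"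
  obtains t where "\<bar>t\<bar> \<le> h" "u (G h *v z) + u (G (- h) *v z) - 2 * u z =
    h\<^sup>2 * (flow_second_derivative M u (G t *v z) + flow_second_derivative M u (G (- t) *v z)) / 2"
proof -
  interpret C2_function u S by fact
  let ?v = "flow_second_derivative M u"
  \<comment> \<open>Taylor's formula of order two for the even function \<open>s \<mapsto> u (G s *v z) + u (G (- s) *v z)\<close>.\<close>
  have d1: "((\<lambda>s. u (G s *v z)) has_real_derivative pd (M *v (G s *v z)) u (G s *v z)) (at s)"
    if "\<bar>s\<bar> \<le> h" for s
    using has_real_derivative_along_curve[OF differentiable_u flow_deriv] in_S that by blast
  have d2: "((\<lambda>s. pd (M *v (G s *v z)) u (G s *v z)) has_real_derivative ?v (G s *v z)) (at s)"
    if "\<bar>s\<bar> \<le> h" for s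
  proof -
    let ?F = "\<lambda>y. pd (M *v y) u y"
    have "bounded_linear (\<lambda>y. (M *v y) \<bullet> b)" for b
      using bounded_linear_compose[OF bounded_linear_inner_left matrix_vector_mul_bounded_linear] .
    then have D: "(?F has_derivative (\<lambda>v. pd (M *v v) u y + hessian u y v (M *v y))) (at y)" if "y \<in> S" for y
      using that by (intro has_derivative_pd_field bounded_linear_imp_has_derivative)
    show ?thesis
      using has_real_derivative_along_curve[of ?F "\<lambda>s. G s *v z" s, OF _ flow_deriv] D[OF in_S[OF that]]
        pd_unique[OF D[OF in_S[OF that]]]
      unfolding flow_second_derivative_def differentiable_def by auto
  qed
  define diff where "diff = (\<lambda>m::nat. if m = 0 then (\<lambda>s. u (G s *v z) + u (G (- s) *v z))
     else if m = 1 then (\<lambda>s. pd (M *v (G s *v z)) u (G s *v z) - pd (M *v (G (- s) *v z)) u (G (- s) *v z))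
     else (\<lambda>s. ?v (G s *v z) + ?v (G (- s) *v z)))"
  have "DERIV (diff m) t :> diff (Suc m) t" if "m < 2" "0 \<le> t" "t \<le> h" for m t
  proof -
    have "((\<lambda>s. u (G (- s) *v z)) has_real_derivative pd (M *v (G (- t) *v z)) u (G (- t) *v z) * - 1) (at t)"
      using that by (intro DERIV_chain2[OF d1]) (auto intro!: derivative_eq_intros)
    moreover have "((\<lambda>s. pd (M *v (G (- s) *v z)) u (G (- s) *v z)) has_real_derivative ?v (G (- t) *v z) * - 1) (at t)"
      using that by (intro DERIV_chain2[OF d2]) (auto intro!: derivative_eq_intros)
    ultimately show ?thesis
      using that d1[of t] d2[of t] unfolding diff_def
      by (auto simp: less_2_cases_iff intro!: derivative_eq_intros)
  qed
  then obtain t where t: "0 < t" "t < h" and e: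
    "u (G h *v z) + u (G (- h) *v z) = (\<Sum>m<2. (diff m 0 / fact m) * h ^ m) + (diff 2 t / fact 2) * h ^ 2"
    using Maclaurin[of h 2 diff "\<lambda>s. u (G s *v z) + u (G (- s) *v z)"] h by (auto simp: diff_def)
  show thesis
    using that[of t] t e by (simp add: diff_def numeral_2_eq_2 flow_0 algebra_simps)
qed

text \<open>The mean value form of the quotient evaluates the second derivative at times of size at most \<open>h\<close>, and these
  values are close to the one at time \<open>0\<close> uniformly on \<open>K\<close> by compactness.\<close>

lemma second_difference_quotient_uniform:
  assumes "C2_function u S" and K: "compact K" "K \<subseteq> S" and \<eta>: "\<eta> > 0"
    and cont: "continuous_on S (flow_second_derivative M u)"
  obtains h where "h > 0" "\<And>z. z \<in> K \<Longrightarrow> G h *v z \<in> S \<and> G (- h) *v z \<in> S \<and>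
    \<bar>(u (G h *v z) + u (G (- h) *v z) - 2 * u z) / h\<^sup>2 - flow_second_derivative M u z\<bar> < \<eta>"
proof -
  interpret C2_function u S by fact
  let ?v = "flow_second_derivative M u"
  let ?P = "\<lambda>(s, z). G s *v z"
  let ?D = "(UNIV \<times> S) \<inter> ?P -` S"
  have oD: "open ?D"
    by (intro open_Int open_Times open_UNIV open_S open_vimage[OF open_S flow_cont])
  have "continuous_on ?D (\<lambda>x. ?v (?P x))"
    by (rule continuous_on_compose2[OF cont continuous_on_subset[OF flow_cont]]) auto
  moreover have "continuous_on ?D (\<lambda>x. ?v (snd x))"
    by (rule continuous_on_compose2[OF cont continuous_on_snd[OF continuous_on_id]]) auto
  ultimately have "continuous_on ?D (\<lambda>x. \<bar>?v (?P x) - ?v (snd x)\<bar>)"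
    by (intro continuous_intros)
  then have oW: "open ((\<lambda>x. \<bar>?v (?P x) - ?v (snd x)\<bar>) -` {..<\<eta>} \<inter> ?D)"
    by (rule continuous_on_open_vimage[OF oD, THEN iffD1, rule_format, OF _ open_lessThan])
  have "{0} \<times> K \<subseteq> (\<lambda>x. \<bar>?v (?P x) - ?v (snd x)\<bar>) -` {..<\<eta>} \<inter> ?D"
    using K \<eta> by (auto simp: flow_0)
  from Elementary_Topology.tube_lemma[OF K(1) oW this] obtain X where X: "0 \<in> X" "open X"
    "X \<times> K \<subseteq> (\<lambda>x. \<bar>?v (?P x) - ?v (snd x)\<bar>) -` {..<\<eta>} \<inter> ?D"
    by blast
  obtain e where e: "e > 0" "\<And>s. dist s 0 < e \<Longrightarrow> s \<in> X"
    using X(1,2) unfolding open_dist by blast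
  define h where "h = e / 2"
  have h: "h > 0" using e by (simp add: h_def)
  have in_X: "s \<in> X" if "\<bar>s\<bar> \<le> h" for s using e that by (simp add: h_def)
  have near: "G s *v z \<in> S" "\<bar>?v (G s *v z) - ?v z\<bar> < \<eta>" if "\<bar>s\<bar> \<le> h" "z \<in> K" for s z
    using X(3) in_X[OF that(1)] that(2) by auto
  have "\<bar>(u (G h *v z) + u (G (- h) *v z) - 2 * u z) / h\<^sup>2 - ?v z\<bar> < \<eta>" if z: "z \<in> K" for z
  proof -
    obtain t where t: "\<bar>t\<bar> \<le> h" "u (G h *v z) + u (G (- h) *v z) - 2 * u z =
      h\<^sup>2 * (?v (G t *v z) + ?v (G (- t) *v z)) / 2"
      using second_difference_quotient[OF assms(1) h near(1)] z by metis
    have "(u (G h *v z) + u (G (- h) *v z) - 2 * u z) / h\<^sup>2 = (?v (G t *v z) + ?v (G (- t) *v z)) / 2"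
      using t(2) h by simp
    moreover have "\<bar>?v (G (- t) *v z) - ?v z\<bar> < \<eta>" using near(2)[of "- t" z] t(1) z by simp
    moreover have "\<bar>(a + b) / 2 - c\<bar> < \<eta>" if "\<bar>a - c\<bar> < \<eta>" "\<bar>b - c\<bar> < \<eta>" for a b c :: real
      using that unfolding abs_less_iff by argo
    ultimately show ?thesis using near(2)[OF t(1) z] by metis
  qed
  then show thesis using that[OF h] near(1)[of h] near(1)[of "- h"] h by simp
qed

text \<open>Suppose that \<open>q\<close> exceeds \<open>\<mu>\<close> somewhere. After adding a small multiple of the squared norm, the maximum
  over the closure is still larger than all values on the frontier, so the set \<open>K\<close> where the sum is close to
  its maximum is a compact subset of \<open>S\<close>. Replacing \<open>q\<close> on \<open>K\<close> by a symmetric second difference quotient of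
  \<open>u\<close> along the flow changes the values so little that the maximum over \<open>K\<close> is attained at an inner point,
  which \<open>no_local_max_of_composition\<close> excludes.\<close>

proposition flow_maximum_principle:
  assumes C2: "C2_function u S" and psh: "plurisubharmonic_on u S"
    and ma: "\<And>z. z \<in> S \<Longrightarrow> det (complex_hessian u z) = d" "d \<noteq> 0"
    and bdd: "bounded S" and cont: "continuous_on (closure S) q"
    and q: "\<And>z. z \<in> S \<Longrightarrow> q z = flow_second_derivative M u z"
    and fr: "\<And>z. z \<in> frontier S \<Longrightarrow> q z \<le> \<mu>" and x: "x \<in> S"
  shows "q x \<le> \<mu>"
proof (rule ccontr)
  interpret C2_function u S by fact
  assume "\<not> q x \<le> \<mu>"
  then have gt: "q x > \<mu>" by simp
  have comp: "compact (closure S)" using bdd by simp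
  obtain R where R: "R > 0" "\<And>z. z \<in> closure S \<Longrightarrow> norm z \<le> R"
    using bounded_pos bounded_closure[OF bdd] by metis
  \<comment> \<open>On the closure the added term is at most half of the excess of \<open>q x\<close> over \<open>\<mu>\<close>.\<close>
  define \<delta> where "\<delta> = (q x - \<mu>) / (2 * R\<^sup>2)"
  have \<delta>: "\<delta> > 0" using gt R by (simp add: \<delta>_def)
  define Q where "Q = (\<lambda>z. q z + \<delta> * (norm z)\<^sup>2)"
  define \<nu> where "\<nu> = \<mu> + \<delta> * R\<^sup>2"
  have "\<delta> * R\<^sup>2 = (q x - \<mu>) / 2" using R by (simp add: \<delta>_def)
  then have \<nu>: "\<nu> < q x" using gt by (simp add: \<nu>_def field_simps)
  have Qc: "continuous_on (closure S) Q"
    unfolding Q_def by (intro continuous_intros cont)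
  have xS: "x \<in> closure S" using x closure_subset by blast
  then have ne: "closure S \<noteq> {}" by (metis empty_iff)
  obtain p0 where p0: "p0 \<in> closure S" "\<And>z. z \<in> closure S \<Longrightarrow> Q z \<le> Q p0"
    using continuous_attains_sup[OF comp ne Qc] by blast
  have m: "Q p0 > \<nu>"
  proof -
    have "\<delta> * (norm x)\<^sup>2 \<ge> 0" using \<delta> by simp
    then show ?thesis using p0(2)[OF xS] \<nu> by (simp add: Q_def)
  qed
  define l where "l = (\<nu> + Q p0) / 2"
  define K where "K = {z \<in> closure S. l \<le> Q z}"
  have fr': "Q z \<le> \<nu>" if "z \<in> frontier S" for z
  proof -
    have "(norm z)\<^sup>2 \<le> R\<^sup>2"
      using R(2)[of z] that by (intro power_mono) (auto simp: frontier_def)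
    then show ?thesis using fr[OF that] \<delta> by (simp add: Q_def \<nu>_def add_mono)
  qed
  have KS: "K \<subseteq> S"
  proof
    fix z assume z: "z \<in> K"
    then have "z \<notin> frontier S" using fr'[of z] m by (auto simp: K_def l_def)
    then show "z \<in> S" using z open_S by (auto simp: K_def frontier_def interior_open)
  qed
  have "closed K"
    unfolding K_def by (intro continuous_on_closed_Collect_le continuous_intros Qc) auto
  then have Kc: "compact K"
    using comp compact_Int_closed[OF comp, of K] by (metis (no_types, lifting) K_def Collect_mono Int_absorb1 mem_Collect_eq subsetI)
  \<comment> \<open>An error below an eighth keeps the maximum point of the quotient well above the level \<open>l\<close>, at half height.\<close>
  define \<eta> where "\<eta> = (Q p0 - \<nu>) / 8"
  have \<eta>: "\<eta> > 0" using m by (simp add: \<eta>_def)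
  have contv: "continuous_on S (flow_second_derivative M u)"
    using continuous_on_eq[OF continuous_on_subset[OF cont closure_subset]] q by blast
  obtain h where h: "h > 0" and near: "\<And>z. z \<in> K \<Longrightarrow> G h *v z \<in> S \<and> G (- h) *v z \<in> S \<and>
    \<bar>(u (G h *v z) + u (G (- h) *v z) - 2 * u z) / h\<^sup>2 - flow_second_derivative M u z\<bar> < \<eta>"
    using second_difference_quotient_uniform[OF C2 Kc KS \<eta> contv] by metis
  define f where "f = (\<lambda>y. u (G h *v y) + u (G (- h) *v y) - 2 * u y + (\<delta> * h\<^sup>2) * (norm y)\<^sup>2)"
  have fQ: "\<bar>f z / h\<^sup>2 - Q z\<bar> < \<eta>" if "z \<in> K" for z
    using near[OF that] q[of z] KS that h by (auto simp: f_def Q_def add_divide_distrib)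
  have contu: "continuous_on S u"
    using differentiable_u by (auto intro!: continuous_at_imp_continuous_on differentiable_imp_continuous_within)
  have "continuous_on K (\<lambda>y. u (G t *v y))" if "\<And>z. z \<in> K \<Longrightarrow> G t *v z \<in> S" for t
    by (rule continuous_on_compose2[OF contu matrix_vector_mult_linear_continuous_on])
      (use that in blast)
  then have "continuous_on K f"
    unfolding f_def using near
    by (intro continuous_on_add continuous_on_diff continuous_on_mult continuous_on_const
        continuous_on_power continuous_on_norm continuous_on_id continuous_on_subset[OF contu KS]) blast+
  moreover have p0K: "p0 \<in> K" using p0 m by (simp add: K_def l_def)
  then have "K \<noteq> {}" by blast
  ultimately obtain p where p: "p \<in> K" "\<And>z. z \<in> K \<Longrightarrow> f z \<le> f p"
    using continuous_attains_sup[OF Kc, of f] by blast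
  have "f p0 / h\<^sup>2 \<le> f p / h\<^sup>2" using p(2)[OF p0K] h by (simp add: divide_right_mono)
  then have Qp: "Q p > l"
    using fQ[OF p0K] fQ[OF p(1)] m unfolding l_def \<eta>_def abs_less_iff by argo
  have "isCont Q p"
    using continuous_on_subset[OF Qc closure_subset] open_S KS p(1) continuous_on_eq_continuous_at
    by blast
  then have "\<forall>\<^sub>F y in nhds p. Q y > l"
    using Qp by (auto simp: isCont_def tendsto_at_iff_tendsto_nhds intro: order_tendstoD)
  moreover have "\<forall>\<^sub>F y in nhds p. y \<in> S"
    using eventually_nhds_in_open[OF open_S] KS p(1) by blast
  ultimately have "\<forall>\<^sub>F y in nhds p. y \<in> K"
    by eventually_elim (use closure_subset in \<open>auto simp: K_def\<close>)
  then obtain e where e: "e > 0" "\<And>y. dist y p < e \<Longrightarrow> y \<in> K"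
    unfolding eventually_nhds_metric by blast
  have "\<exists>y. dist y p < e \<and> f p < f y"
    unfolding f_def
    using near[OF p(1)] KS p(1) \<delta> h e(1)
    by (intro no_local_max_of_composition[OF C2 psh ma]) (auto simp: flow_inverse)
  then show False using p(2) e(2) by force
qed

end

lemma has_vector_derivative_vec:
  fixes f :: "real \<Rightarrow> 'a::euclidean_space ^ 'n::finite"
  assumes "\<And>i. ((\<lambda>s. f s $ i) has_vector_derivative f' $ i) (at s)"
  shows "(f has_vector_derivative f') (at s)"
  unfolding has_vector_derivative_def
proof (subst has_derivative_componentwise_within, intro ballI)
  fix b :: "'a ^ 'n" assume "b \<in> Basis"
  then obtain i c where b: "b = axis i c" by (auto simp: Basis_vec_def)
  have "((\<lambda>s. f s $ i \<bullet> c) has_derivative (\<lambda>x. (x *\<^sub>R f' $ i) \<bullet> c)) (at s)"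
    using assms[of i] unfolding has_vector_derivative_def by (rule has_derivative_inner_left)
  then show "((\<lambda>x. f x \<bullet> b) has_derivative (\<lambda>x. (x *\<^sub>R f') \<bullet> b)) (at s)"
    by (simp add: b inner_axis)
qed

text \<open>With \<open>c $ k = 0\<close> this is a scalar matrix plus a commuting matrix of square zero, so its exponential is
  elementary, yet such matrices can map a given nonzero vector to any other one.\<close>

definition flow_generator :: "'n \<Rightarrow> complex \<Rightarrow> complex ^ 'n \<Rightarrow> complex ^ 'n ^ 'n::finite" where
  "flow_generator k \<alpha> c = (\<chi> i j. (if i = j then \<alpha> else 0) + (if j = k then c $ i else 0))"

lemma flow_generator_nth: "(flow_generator k \<alpha> c *v z) $ i = \<alpha> * z $ i + c $ i * z $ k"
  by (simp add: flow_generator_def matrix_vector_mult_def distrib_right sum.distrib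
      if_distrib[of "\<lambda>a. a * _"] cong: if_cong)

lemma flow_generator_apply: "flow_generator k \<alpha> c *v z = \<alpha> *s z + z $ k *s c"
  by (simp add: vec_eq_iff flow_generator_nth)

lemma linear_flow_scalar_plus_nilpotent:
  fixes c :: "complex ^ 'n::finite"
  assumes "c $ k = 0"
  shows "linear_flow
    (\<lambda>s. \<chi> i j. exp (of_real s * \<alpha>) * ((if i = j then 1 else 0) + (if j = k then of_real s * c $ i else 0)))
    (flow_generator k \<alpha> c)"
    (is "linear_flow ?G ?M")
proof
  have G: "(?G s *v z) $ i = exp (of_real s * \<alpha>) * (z $ i + of_real s * c $ i * z $ k)" for s z i
  proof -
    have "(?G s *v z) $ i = (\<Sum>j\<in>UNIV. exp (of_real s * \<alpha>) * ((if i = j then z $ j else 0)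
        + (if j = k then of_real s * c $ i * z $ j else 0)))"
      unfolding matrix_vector_mult_def by (auto intro!: sum.cong simp: algebra_simps)
    also have "\<dots> = exp (of_real s * \<alpha>) * (z $ i + of_real s * c $ i * z $ k)"
      by (simp add: sum_distrib_left[symmetric] sum.distrib)
    finally show ?thesis .
  qed
  show "?G 0 = mat 1" by (simp add: vec_eq_iff mat_def)
  show "((\<lambda>s. ?G s *v z) has_vector_derivative ?M *v (?G s *v z)) (at s)" for z s
  proof (rule has_vector_derivative_vec)
    fix i
    have "((\<lambda>s. exp (s * \<alpha>) * (z $ i + s * c $ i * z $ k)) has_field_derivative
       (\<alpha> * (exp (of_real s * \<alpha>) * (z $ i + of_real s * c $ i * z $ k)) + c $ i * (exp (of_real s * \<alpha>) * z $ k)))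
       (at (of_real s))"
      by (auto intro!: derivative_eq_intros simp: algebra_simps)
    then show "((\<lambda>s. (?G s *v z) $ i) has_vector_derivative (?M *v (?G s *v z)) $ i) (at s)"
      unfolding flow_generator_nth G using assms has_vector_derivative_real_field by fastforce
  qed
  have "continuous_on UNIV (\<lambda>x. \<chi> i. exp (of_real (fst x) * \<alpha>) * (snd x $ i + of_real (fst x) * c $ i * snd x $ k))"
    by (intro continuous_intros)
  moreover have "(\<lambda>x. \<chi> i. exp (of_real (fst x) * \<alpha>) * (snd x $ i + of_real (fst x) * c $ i * snd x $ k)) =
     (\<lambda>(s, z). ?G s *v z)"
    by (auto simp: fun_eq_iff vec_eq_iff G)
  ultimately show "continuous_on UNIV (\<lambda>(s, z). ?G s *v z)"
    by (rule back_subst[of "continuous_on UNIV"])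
  show "?G (- s) ** ?G s = mat 1" for s
  proof (rule matrix_eq[THEN iffD2], intro allI)
    fix z :: "complex ^ 'n"
    have "exp (- (of_real s * \<alpha>)) * exp (of_real s * \<alpha>) = 1" by (simp add: exp_minus)
    then have "(?G (- s) *v (?G s *v z)) $ i = z $ i" for i
      unfolding G using assms by (simp add: algebra_simps)
    then show "?G (- s) ** ?G s *v z = mat 1 *v z"
      unfolding matrix_vector_mul_assoc[symmetric] matrix_vector_mul_lid vec_eq_iff by blast
  qed
qed

section \<open>Boundary values of the derivatives\<close>

text \<open>Any continuous function on the closure that agrees with \<open>f\<close> on \<open>S\<close> has the values of \<open>cont_ext\<close>, so
  the choice of the extension is immaterial.\<close>

lemma cont_ext_eq:
  fixes f :: "'a::topological_space \<Rightarrow> 'b::t2_space"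
  assumes g: "continuous_on (closure S) g" "\<And>z. z \<in> S \<Longrightarrow> g z = f z" and z: "z \<in> closure S"
  shows "cont_ext S f z = g z"
proof (cases "z \<in> S")
  case True
  then show ?thesis using g by (simp add: cont_ext_def)
next
  case False
  then have "z islimpt S" using z unfolding closure_def by blast
  then have nontriv: "\<not> trivial_limit (at z within S)" by (simp add: trivial_limit_within)
  have "(g \<longlongrightarrow> g z) (at z within closure S)"
    using g(1) z unfolding continuous_on_def by blast
  then have "(g \<longlongrightarrow> g z) (at z within S)"
    using closure_subset by (rule tendsto_within_subset)
  moreover have "\<forall>\<^sub>F x in at z within S. g x = f x"
    using g(2) by (auto simp: eventually_at_filter)
  ultimately have "(f \<longlongrightarrow> g z) (at z within S)"
    by (rule Lim_transform_eventually)
  then show ?thesis using False nontriv by (simp add: cont_ext_def tendsto_Lim)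
qed

lemma continuous_on_cont_ext:
  fixes f :: "'a::topological_space \<Rightarrow> 'b::t2_space"
  assumes "extends_to_closure f S"
  shows "continuous_on (closure S) (cont_ext S f)"
proof -
  obtain g where g: "continuous_on (closure S) g" "\<And>z. z \<in> S \<Longrightarrow> g z = f z"
    using assms unfolding extends_to_closure_def by blast
  show ?thesis
    using continuous_on_eq[OF g(1)] cont_ext_eq[OF g] by metis
qed

lemma
  assumes "Ck_closure 2 u S" "b \<in> Basis"
  shows continuous_on_cont_ext_pd: "continuous_on (closure S) (cont_ext S (pd b u))"
    and continuous_on_cont_ext_pd2: "a \<in> Basis \<Longrightarrow> continuous_on (closure S) (cont_ext S (pd a (pd b u)))"
  using assms by (auto simp: numeral_2_eq_2 intro!: continuous_on_cont_ext)

lemma abs_pd_le_norm_grad: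
  assumes "b \<in> Basis"
  shows "\<bar>pd b u z\<bar> \<le> norm (grad u z)"
proof -
  have "grad u z \<bullet> b = pd b u z"
    using assms by (simp add: grad_def inner_sum_left inner_Basis if_distrib[of "\<lambda>x. _ * x"] cong: if_cong)
  then show ?thesis using Basis_le_norm[OF assms, of "grad u z"] by simp
qed

lemma abs_le_hess_norm:
  assumes "a \<in> Basis" "b \<in> Basis"
  shows "\<bar>cont_ext S (pd a (pd b u)) z\<bar> \<le> hess_norm S u z"
proof -
  let ?U = "\<lambda>a b. (cont_ext S (pd a (pd b u)) z)\<^sup>2"
  have "?U a b \<le> (\<Sum>b\<in>Basis. ?U a b)"
    by (rule member_le_sum) (use assms in auto)
  also have "\<dots> \<le> (\<Sum>a\<in>Basis. \<Sum>b\<in>Basis. ?U a b)"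
    by (rule member_le_sum) (use assms in \<open>auto intro: sum_nonneg\<close>)
  finally have "sqrt (?U a b) \<le> hess_norm S u z"
    unfolding hess_norm_def by (rule real_sqrt_le_mono)
  then show ?thesis by simp
qed

lemma gradient_bound_on_closure:
  fixes u :: "'a::euclidean_space \<Rightarrow> real"
  assumes C: "Ck_closure 2 u S" and g: "\<And>z. z \<in> S \<Longrightarrow> norm z * norm (grad u z) \<le> C1"
    and b: "b \<in> Basis" and z: "z \<in> closure S"
  shows "norm z * \<bar>cont_ext S (pd b u) z\<bar> \<le> C1"
proof (rule continuous_le_on_closure[OF _ z])
  show "continuous_on (closure S) (\<lambda>z. norm z * \<bar>cont_ext S (pd b u) z\<bar>)"
    by (intro continuous_intros continuous_on_cont_ext_pd[OF C b])
  fix y assume y: "y \<in> S"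
  have "norm y * \<bar>cont_ext S (pd b u) y\<bar> \<le> norm y * norm (grad u y)"
    using y abs_pd_le_norm_grad[OF b] by (simp add: cont_ext_def mult_left_mono)
  then show "norm y * \<bar>cont_ext S (pd b u) y\<bar> \<le> C1" using g[OF y] by linarith
qed

section \<open>The Hessian estimate\<close>

text \<open>Choosing for \<open>k\<close> the largest coordinate of \<open>z\<close> keeps the division by \<open>z $ k\<close> harmless and makes the norm of
  the generator bounded in terms of the dimension alone.\<close>

lemma flow_generator_exists:
  fixes z w :: "complex ^ 'n::finite"
  assumes z: "z \<noteq> 0" and w: "norm w = 1"
  defines "n \<equiv> real CARD('n)"
  obtains k \<alpha> c where "c $ k = 0" "flow_generator k \<alpha> c *v z = norm z *\<^sub>R w"
    "\<And>y. norm (flow_generator k \<alpha> c *v y) \<le> n * (n + 2) * norm y"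
proof -
  have "Max (range (\<lambda>i. norm (z $ i))) \<in> range (\<lambda>i. norm (z $ i))"
    by (rule Max_in) auto
  then obtain k where "Max (range (\<lambda>i. norm (z $ i))) = norm (z $ k)" by blast
  note k = this[symmetric]
  have "norm z \<le> (\<Sum>i\<in>UNIV. norm (z $ i))"
    unfolding norm_vec_def by (rule L2_set_le_sum) auto
  also have "\<dots> \<le> (\<Sum>i\<in>(UNIV::'n set). norm (z $ k))"
    unfolding k by (intro sum_mono Max_ge) auto
  finally have nz: "norm z \<le> n * norm (z $ k)" by (simp add: n_def)
  then have zk: "z $ k \<noteq> 0" using z by auto
  have n0: "n \<ge> 0" by (simp add: n_def)
  have q: "norm z / norm (z $ k) \<le> n" using nz zk by (simp add: divide_le_eq)
  define \<alpha> where "\<alpha> = norm z *\<^sub>R (w $ k) / z $ k"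
  define c where "c = (1 / z $ k) *s (norm z *\<^sub>R w - \<alpha> *s z)"
  have "c $ k = 0" using zk by (simp add: c_def \<alpha>_def scaleR_conv_of_real[where 'a=complex])
  moreover have "flow_generator k \<alpha> c *v z = norm z *\<^sub>R w"
    using zk by (simp add: flow_generator_apply c_def vec_eq_iff)
  moreover have "norm (flow_generator k \<alpha> c *v y) \<le> n * (n + 2) * norm y" for y
  proof -
    have wk: "norm (w $ k) \<le> 1" using Finite_Cartesian_Product.norm_nth_le[of w k] w by simp
    have "norm \<alpha> = (norm z / norm (z $ k)) * norm (w $ k)" by (simp add: \<alpha>_def norm_mult norm_divide)
    also have "\<dots> \<le> n * 1" using q wk n0 by (intro mult_mono) auto
    finally have a: "norm \<alpha> \<le> n" by simp
    have "norm (norm z *\<^sub>R w - \<alpha> *s z) \<le> norm z + norm \<alpha> * norm z"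
      using norm_triangle_ineq4[of "norm z *\<^sub>R w" "\<alpha> *s z"] w by (simp add: norm_vector_scalar_mult)
    also have "\<dots> \<le> norm z * (1 + n)" using a by (simp add: algebra_simps mult_right_mono)
    finally have "norm c \<le> norm z * (1 + n) / norm (z $ k)"
      unfolding c_def norm_vector_scalar_mult by (simp add: norm_divide divide_right_mono)
    also have "\<dots> = (norm z / norm (z $ k)) * (1 + n)" by simp
    also have "\<dots> \<le> n * (1 + n)" using q n0 by (intro mult_right_mono) auto
    finally have cn: "norm c \<le> n * (1 + n)" .
    have "norm (flow_generator k \<alpha> c *v y) \<le> norm \<alpha> * norm y + norm (y $ k) * norm c"
      unfolding flow_generator_apply using norm_triangle_ineq[of "\<alpha> *s y" "y $ k *s c"]
      by (simp add: norm_vector_scalar_mult)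
    also have "\<dots> \<le> n * norm y + norm y * (n * (1 + n))"
      using a cn n0 Finite_Cartesian_Product.norm_nth_le[of y k] by (intro add_mono mult_mono) auto
    finally show ?thesis by (simp add: algebra_simps)
  qed
  ultimately show thesis by (rule that)
qed

lemma abs_sum_Basis_le:
  fixes x :: "'a::euclidean_space"
  assumes "\<And>b. b \<in> Basis \<Longrightarrow> \<bar>g b\<bar> \<le> B"
  shows "\<bar>\<Sum>b\<in>Basis. (x \<bullet> b) * g b\<bar> \<le> real DIM('a) * (norm x * B)"
proof -
  have "\<bar>\<Sum>b\<in>Basis. (x \<bullet> b) * g b\<bar> \<le> (\<Sum>b\<in>(Basis :: 'a set). norm x * B)"
    using assms Basis_le_norm
    by (intro order_trans[OF sum_abs] sum_mono) (auto simp: abs_mult intro!: mult_mono)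
  then show ?thesis by simp
qed

text \<open>The function \<open>q1 + q2\<close> is the continuous extension of the second derivative along the flow whose generator
  \<open>M\<close> maps \<open>z\<close> to \<open>norm z *\<^sub>R w\<close>. Because the field \<open>M *v y\<close> has size of order \<open>norm y\<close>, the weights in the
  hypotheses are exactly those that bound \<open>q1\<close> on the closure and \<open>q2\<close> on the frontier by constants.\<close>

lemma directional_bound:
  fixes u :: "complex ^ 'n::finite \<Rightarrow> real"
  assumes C2: "C2_function u S" and clo: "Ck_closure 2 u S" and psh: "plurisubharmonic_on u S"
    and ma: "\<And>z. z \<in> S \<Longrightarrow> det (complex_hessian u z) = d" "d \<noteq> 0"
    and bdd: "bounded S" and nz: "0 \<notin> closure S"
    and bd: "\<And>z. z \<in> frontier S \<Longrightarrow> (norm z)\<^sup>2 * hess_norm S u z \<le> C2"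
    and gr: "\<And>z. z \<in> S \<Longrightarrow> norm z * norm (grad u z) \<le> C1"
    and z: "z \<in> S" and w: "norm w = 1"
  defines "D \<equiv> real DIM(complex ^ 'n)" and "\<kappa> \<equiv> real CARD('n) * (real CARD('n) + 2)"
  shows "(norm z)\<^sup>2 * hessian u z w w \<le> \<kappa>\<^sup>2 * (D\<^sup>2 * C2 + 2 * D * C1)"
proof -
  interpret C2_function u S by fact
  have zc: "z \<in> closure S" using z closure_subset by blast
  have z0: "z \<noteq> 0" using zc nz by auto
  obtain k \<alpha> c where k: "c $ k = 0" "flow_generator k \<alpha> c *v z = norm z *\<^sub>R w"
    and M_bound: "\<And>y. norm (flow_generator k \<alpha> c *v y) \<le> \<kappa> * norm y"
    using flow_generator_exists[OF z0 w] unfolding \<kappa>_def by metis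
  define M where "M = flow_generator k \<alpha> c"
  obtain G where "linear_flow G M"
    using linear_flow_scalar_plus_nilpotent[OF k(1)] unfolding M_def by blast
  then interpret linear_flow G M .
  define q1 where "q1 = (\<lambda>y. \<Sum>b\<in>Basis. ((M *v (M *v y)) \<bullet> b) * cont_ext S (pd b u) y)"
  define q2 where "q2 = (\<lambda>y. \<Sum>a\<in>Basis. ((M *v y) \<bullet> a) * (\<Sum>b\<in>Basis. ((M *v y) \<bullet> b) * cont_ext S (pd a (pd b u)) y))"
  have cM: "continuous_on T (\<lambda>y. M *v f y)" if "continuous_on T f" for T f
    by (rule continuous_on_compose2[OF matrix_vector_mult_linear_continuous_on that]) auto
  have cont: "continuous_on (closure S) (\<lambda>y. q1 y + q2 y)"
    unfolding q1_def q2_def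
    by (intro continuous_intros cM continuous_on_cont_ext_pd[OF clo] continuous_on_cont_ext_pd2[OF clo])
  have q1: "q1 y = pd (M *v (M *v y)) u y" if "y \<in> S" for y
    using that by (simp add: q1_def pd_u[OF that, of "M *v (M *v y)"] cont_ext_def)
  have q2: "q2 y = hessian u y (M *v y) (M *v y)" if "y \<in> S" for y
    using that by (simp add: q2_def hessian_def cont_ext_def sum_distrib_left mult.assoc)
  have \<kappa>0: "\<kappa> \<ge> 0" by (simp add: \<kappa>_def)
  have D0: "D \<ge> 0" by (simp add: D_def)
  have Mb: "norm (M *v y) \<le> \<kappa> * norm y" for y using M_bound by (simp add: M_def)
  have MMb: "norm (M *v (M *v y)) \<le> \<kappa>\<^sup>2 * norm y" for y
  proof -
    have "norm (M *v (M *v y)) \<le> \<kappa> * (\<kappa> * norm y)"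
      using Mb[of "M *v y"] mult_left_mono[OF Mb[of y] \<kappa>0] by linarith
    then show ?thesis by (simp add: power2_eq_square mult.assoc)
  qed
  have q1_bound: "\<bar>q1 y\<bar> \<le> \<kappa>\<^sup>2 * (D * C1)" if y: "y \<in> closure S" for y
  proof -
    have y0: "norm y > 0" using y nz by auto
    have "\<bar>cont_ext S (pd b u) y\<bar> \<le> C1 / norm y" if "b \<in> Basis" for b
      using gradient_bound_on_closure[OF clo gr that y] y0 by (simp add: field_simps)
    then have "\<bar>q1 y\<bar> \<le> D * (norm (M *v (M *v y)) * (C1 / norm y))"
      unfolding q1_def D_def by (rule abs_sum_Basis_le)
    also have "\<dots> \<le> D * ((\<kappa>\<^sup>2 * norm y) * (C1 / norm y))"
    proof (intro mult_left_mono[OF _ D0] mult_right_mono MMb)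
      obtain b :: "complex ^ 'n" where b: "b \<in> Basis" using nonempty_Basis by blast
      have "0 \<le> norm y * \<bar>cont_ext S (pd b u) y\<bar>" by simp
      then have "C1 \<ge> 0" using gradient_bound_on_closure[OF clo gr b y] by linarith
      then show "0 \<le> C1 / norm y" by simp
    qed
    finally show ?thesis using y0 by (simp add: mult_ac)
  qed
  have q2_bound: "q2 y \<le> \<kappa>\<^sup>2 * (D\<^sup>2 * C2)" if y: "y \<in> frontier S" for y
  proof -
    let ?h = "hess_norm S u y"
    have h0: "?h \<ge> 0" by (simp add: hess_norm_def sum_nonneg)
    have "\<bar>\<Sum>b\<in>Basis. ((M *v y) \<bullet> b) * cont_ext S (pd a (pd b u)) y\<bar> \<le> D * (norm (M *v y) * ?h)"
      if "a \<in> Basis" for a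
      unfolding D_def using abs_le_hess_norm[OF that] by (intro abs_sum_Basis_le)
    then have "\<bar>q2 y\<bar> \<le> D * (norm (M *v y) * (D * (norm (M *v y) * ?h)))"
      unfolding q2_def D_def by (rule abs_sum_Basis_le)
    also have "\<dots> = D\<^sup>2 * ((norm (M *v y))\<^sup>2 * ?h)" by (simp add: power2_eq_square mult_ac)
    also have "\<dots> \<le> D\<^sup>2 * ((\<kappa> * norm y)\<^sup>2 * ?h)"
      using Mb[of y] h0 by (intro mult_left_mono mult_right_mono power_mono) auto
    also have "\<dots> = \<kappa>\<^sup>2 * D\<^sup>2 * ((norm y)\<^sup>2 * ?h)" by (simp add: power_mult_distrib mult_ac)
    also have "\<dots> \<le> \<kappa>\<^sup>2 * D\<^sup>2 * C2" using bd[OF y] by (intro mult_left_mono) auto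
    finally show ?thesis by (simp add: mult.assoc)
  qed
  have "q1 z + q2 z \<le> \<kappa>\<^sup>2 * (D * C1) + \<kappa>\<^sup>2 * (D\<^sup>2 * C2)"
  proof (rule flow_maximum_principle[OF C2 psh ma bdd cont _ _ z])
    show "q1 y + q2 y = flow_second_derivative M u y" if "y \<in> S" for y
      using that by (simp add: flow_second_derivative_def q1 q2)
    show "q1 y + q2 y \<le> \<kappa>\<^sup>2 * (D * C1) + \<kappa>\<^sup>2 * (D\<^sup>2 * C2)" if "y \<in> frontier S" for y
    proof -
      have "y \<in> closure S" using that by (simp add: frontier_def)
      then show ?thesis using q1_bound[of y] q2_bound[OF that] by linarith
    qed
  qed
  moreover have "q2 z = (norm z)\<^sup>2 * hessian u z w w"
    using k(2) by (simp add: q2[OF z] M_def hessian_bilinear power2_eq_square)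
  ultimately show ?thesis
    using q1_bound[OF zc] unfolding abs_le_iff by (simp add: algebra_simps)
qed

text \<open>The directional bound is one-sided. Plurisubharmonicity turns the upper bound in the direction \<open>\<i> *s w\<close> into
  a lower bound in the direction \<open>w\<close>, and polarization passes from the quadratic form to its entries.\<close>

proposition interior_hessian_bound:
  fixes u :: "complex ^ 'n::finite \<Rightarrow> real"
  assumes C2: "C2_function u S" and clo: "Ck_closure 2 u S" and psh: "plurisubharmonic_on u S"
    and ma: "\<And>z. z \<in> S \<Longrightarrow> det (complex_hessian u z) = d" "d \<noteq> 0"
    and bdd: "bounded S" and nz: "0 \<notin> closure S"
    and bd: "\<And>z. z \<in> frontier S \<Longrightarrow> (norm z)\<^sup>2 * hess_norm S u z \<le> C2"
    and gr: "\<And>z. z \<in> S \<Longrightarrow> norm z * norm (grad u z) \<le> C1"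
    and z: "z \<in> S"
  defines "D \<equiv> real DIM(complex ^ 'n)" and "\<kappa> \<equiv> real CARD('n) * (real CARD('n) + 2)"
  shows "hess_norm S u z \<le> 2 * D * (\<kappa>\<^sup>2 * (D\<^sup>2 * C2 + 2 * D * C1)) / (norm z)\<^sup>2"
proof -
  interpret C2_function u S by fact
  define B where "B = \<kappa>\<^sup>2 * (D\<^sup>2 * C2 + 2 * D * C1) / (norm z)\<^sup>2"
  have z0: "norm z > 0" using z nz closure_subset by fastforce
  have upper: "hessian u z w w \<le> B" if "norm w = 1" for w
    using directional_bound[OF C2 clo psh ma bdd nz bd gr z that] z0
    unfolding B_def D_def \<kappa>_def by (simp add: pos_le_divide_eq mult.commute)
  have unit: "\<bar>hessian u z w w\<bar> \<le> B" if w: "norm w = 1" for w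
  proof -
    have "hessian u z w w + hessian u z (\<i> *s w) (\<i> *s w) \<ge> 0"
      using plurisubharmonic_imp_levi_form_nonneg[OF C2 psh z, of w] by (simp add: levi_form_def)
    moreover have "hessian u z (\<i> *s w) (\<i> *s w) \<le> B"
      using w by (intro upper) (simp add: norm_vector_scalar_mult)
    ultimately show ?thesis using upper[OF w] by linarith
  qed
  have quad: "\<bar>hessian u z x x\<bar> \<le> B * (norm x)\<^sup>2" for x
  proof (cases "x = 0")
    case True
    then show ?thesis by (simp add: hessian_def)
  next
    case False
    define y where "y = (1 / norm x) *\<^sub>R x"
    have y: "norm y = 1" "x = norm x *\<^sub>R y" using False by (auto simp: y_def)
    have "hessian u z x x = (norm x)\<^sup>2 * hessian u z y y"
      by (subst (1 2) y(2)) (simp only: hessian_bilinear power2_eq_square mult.assoc)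
    then show ?thesis using mult_left_mono[OF unit[OF y(1)], of "(norm x)\<^sup>2"] by (simp add: abs_mult mult.commute)
  qed
  obtain e :: "complex ^ 'n" where "e \<in> Basis" using nonempty_Basis by blast
  then have B0: "B \<ge> 0" using unit[of e] by simp
  have entry: "\<bar>hessian u z a b\<bar> \<le> 2 * B" if ab: "a \<in> Basis" "b \<in> Basis" for a b
  proof -
    have "4 * hessian u z a b = hessian u z (a + b) (a + b) - hessian u z (a - b) (a - b)"
      using hessian_sym[OF z, of a b] by (simp add: hessian_bilinear)
    moreover have "\<bar>hessian u z x x\<bar> \<le> 4 * B" if "norm x \<le> 2" for x
    proof -
      have "(norm x)\<^sup>2 \<le> 2\<^sup>2" using that by (intro power_mono) auto
      then have "B * (norm x)\<^sup>2 \<le> B * 2\<^sup>2" using B0 by (rule mult_left_mono)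
      then show ?thesis using quad[of x] by simp
    qed
    moreover have "norm (a + b) \<le> 2" "norm (a - b) \<le> 2"
      using norm_triangle_ineq[of a b] norm_triangle_ineq4[of a b] ab by auto
    ultimately show ?thesis by (smt (verit))
  qed
  have "(\<Sum>a\<in>Basis. \<Sum>b\<in>Basis. (cont_ext S (pd a (pd b u)) z)\<^sup>2) \<le>
      (\<Sum>a\<in>(Basis :: (complex ^ 'n) set). \<Sum>b\<in>(Basis :: (complex ^ 'n) set). (2 * B)\<^sup>2)"
  proof (intro sum_mono)
    fix a b :: "complex ^ 'n" assume ab: "a \<in> Basis" "b \<in> Basis"
    have "\<bar>cont_ext S (pd a (pd b u)) z\<bar> \<le> 2 * B"
      using entry[OF ab] z by (simp add: cont_ext_def pd_pd_u)
    then show "(cont_ext S (pd a (pd b u)) z)\<^sup>2 \<le> (2 * B)\<^sup>2"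
      using power_mono[of "\<bar>cont_ext S (pd a (pd b u)) z\<bar>" "2 * B" 2] by simp
  qed
  also have "\<dots> = (D * (2 * B))\<^sup>2" by (simp add: D_def power2_eq_square)
  finally have "hess_norm S u z \<le> D * (2 * B)"
    unfolding hess_norm_def using B0 by (intro real_le_lsqrt) (auto simp: D_def)
  then show ?thesis by (simp add: B_def mult.assoc mult.left_commute)
qed

theorem proposition3p2:
  fixes \<Omega> :: "(complex ^ 'n::finite) set"
    and E :: "real set"
    and u :: "real \<Rightarrow> complex ^ 'n \<Rightarrow> real"
    and C1 C2 :: real
  defines "\<Omega>\<^sub>e \<equiv> \<lambda>\<epsilon>. \<Omega> - cball 0 \<epsilon>"
  assumes "smooth_bounded_strongly_pseudoconvex_domain \<Omega>" and "0 \<in> \<Omega>"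
    and "\<And>\<epsilon>. \<epsilon> \<in> E \<Longrightarrow> \<epsilon> > 0 \<and> cball 0 \<epsilon> \<subseteq> \<Omega>"
    and "\<And>\<epsilon>. \<epsilon> \<in> E \<Longrightarrow> Ck_on 4 (u \<epsilon>) (\<Omega>\<^sub>e \<epsilon>) \<and> Ck_closure 2 (u \<epsilon>) (\<Omega>\<^sub>e \<epsilon>)"
    and "\<And>\<epsilon>. \<epsilon> \<in> E \<Longrightarrow> plurisubharmonic_on (u \<epsilon>) (\<Omega>\<^sub>e \<epsilon>)"
    and "\<And>\<epsilon> z. \<epsilon> \<in> E \<Longrightarrow> z \<in> \<Omega>\<^sub>e \<epsilon> \<Longrightarrow> det (complex_hessian (u \<epsilon>) z) = complex_of_real \<epsilon>"
    and "\<And>\<epsilon> z. \<epsilon> \<in> E \<Longrightarrow> z \<in> frontier (\<Omega>\<^sub>e \<epsilon>) \<Longrightarrow>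
           (norm z)\<^sup>2 * hess_norm (\<Omega>\<^sub>e \<epsilon>) (u \<epsilon>) z \<le> C2"
    and "\<And>\<epsilon> z. \<epsilon> \<in> E \<Longrightarrow> z \<in> \<Omega>\<^sub>e \<epsilon> \<Longrightarrow> norm z * norm (grad (u \<epsilon>) z) \<le> C1"
  shows "\<exists>C>0. \<forall>\<epsilon>\<in>E. \<forall>z\<in>closure (\<Omega>\<^sub>e \<epsilon>).
           hess_norm (\<Omega>\<^sub>e \<epsilon>) (u \<epsilon>) z \<le> C / (norm z)\<^sup>2"
proof -
  define D where "D = real DIM(complex ^ 'n)"
  define \<kappa> where "\<kappa> = real CARD('n) * (real CARD('n) + 2)"
  define B where "B = 2 * D * (\<kappa>\<^sup>2 * (D\<^sup>2 * C2 + 2 * D * C1))"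
  define C where "C = max 1 (max C2 B)"
  have "hess_norm (\<Omega>\<^sub>e \<epsilon>) (u \<epsilon>) z \<le> C / (norm z)\<^sup>2" if \<epsilon>: "\<epsilon> \<in> E" and z: "z \<in> closure (\<Omega>\<^sub>e \<epsilon>)" for \<epsilon> z
  proof -
    have dom: "open \<Omega>" "bounded \<Omega>"
      using assms(2) by (auto simp: smooth_bounded_strongly_pseudoconvex_domain_def)
    have pos: "\<epsilon> > 0" using assms(4) \<epsilon> by blast
    have op: "open (\<Omega>\<^sub>e \<epsilon>)" using dom by (simp add: \<Omega>\<^sub>e_def open_Diff)
    have bdd: "bounded (\<Omega>\<^sub>e \<epsilon>)" using dom by (simp add: \<Omega>\<^sub>e_def bounded_diff)
    have "closure (\<Omega>\<^sub>e \<epsilon>) \<subseteq> - ball 0 \<epsilon>"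
      by (rule closure_minimal) (auto simp: \<Omega>\<^sub>e_def closed_Compl)
    then have away: "norm y \<ge> \<epsilon>" if "y \<in> closure (\<Omega>\<^sub>e \<epsilon>)" for y using that by auto
    have four: "(4 :: nat) = Suc (Suc 2)" by simp
    have "Ck_on 2 (u \<epsilon>) (\<Omega>\<^sub>e \<epsilon>)"
      using assms(5)[OF \<epsilon>] unfolding four by (blast intro: Ck_on_Suc_imp_Ck_on)
    then have C2: "C2_function (u \<epsilon>) (\<Omega>\<^sub>e \<epsilon>)" using op by unfold_locales
    have "hess_norm (\<Omega>\<^sub>e \<epsilon>) (u \<epsilon>) z \<le> max C2 B / (norm z)\<^sup>2"
    proof (cases "z \<in> \<Omega>\<^sub>e \<epsilon>")
      case True
      have "hess_norm (\<Omega>\<^sub>e \<epsilon>) (u \<epsilon>) z \<le> B / (norm z)\<^sup>2"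
        unfolding B_def D_def \<kappa>_def
      proof (rule interior_hessian_bound[OF C2])
        show "0 \<notin> closure (\<Omega>\<^sub>e \<epsilon>)" using away[of 0] pos by auto
        show "complex_of_real \<epsilon> \<noteq> 0" using pos by simp
      qed (use assms \<epsilon> bdd True in auto)
      also have "\<dots> \<le> max C2 B / (norm z)\<^sup>2" by (simp add: divide_right_mono)
      finally show ?thesis .
    next
      case False
      then have "z \<in> frontier (\<Omega>\<^sub>e \<epsilon>)" using z op by (simp add: frontier_def interior_open)
      moreover have "(norm z)\<^sup>2 > 0" using away[OF z] pos by (smt (verit) zero_less_power2)
      ultimately have "hess_norm (\<Omega>\<^sub>e \<epsilon>) (u \<epsilon>) z \<le> C2 / (norm z)\<^sup>2"
        using assms(8)[OF \<epsilon>, of z] by (simp add: pos_le_divide_eq mult.commute)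
      also have "\<dots> \<le> max C2 B / (norm z)\<^sup>2" by (simp add: divide_right_mono)
      finally show ?thesis .
    qed
    also have "\<dots> \<le> C / (norm z)\<^sup>2" by (simp add: C_def divide_right_mono)
    finally show ?thesis .
  qed
  moreover have "C > 0" by (simp add: C_def)
  ultimately show ?thesis by blast
qed

end
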